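(* Let $n\ge 1$ be an integer and suppose that either $N=1$ and $0<\alpha\le 1$, or $N=2$ and $1<\alpha<2$. Let $U(t,x)$, $t\ge 0$, $x\in\mathbf{R}^N$, be the $\mathbf{R}^n$-valued stationary pinned string $$U(t,x)=\int_{-\infty}^{t}\int_{\mathbf{R}^N}\left[G(t-s,x-y)-G(-s,-y)\right]F(dy\,ds),$$ and put $X_t=K_\alpha U(t,0)$ for $t\ge 0$, where $$K_\alpha=\left[\frac{(2-\alpha)\,\Gamma(\frac{N}{2})}{2^{-\frac{3\alpha}{2}+1}\,\Gamma(\frac{N-\alpha}{2})}\right]^{1/2}\ \text{ if }\alpha\neq 1,\qquad K_\alpha=2^{-1/2}(4\pi)^{N/4}\ \text{ if }\alpha=1.$$ Then $(X_t)_{t\ge 0}$ is a fractional Brownian motion in $\mathbf{R}^n$ with Hurst parameter $H=\frac{2-\alpha}{4}$.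
   Context: Kernel: $G(t,x)=(4\pi t)^{-N/2}\exp(-|x|^2/(4t))$ for $t>0$, $x\in\mathbf{R}^N$, and $G(t,x)=0$ for $t\le 0$. Noise: for real-valued functions $f,g$ on $\mathbf{R}\times\mathbf{R}^N$ let $Q(f,g)=\int_{\mathbf{R}}\int_{\mathbf{R}^N}f(t,x)g(t,x)\,dx\,dt$ if $\alpha=1$ (that is, $H=\frac14$), and $Q(f,g)=\int_{\mathbf{R}}\int_{\mathbf{R}^N\times\mathbf{R}^N}f(t,x)g(t,y)|x-y|^{-\alpha}\,dy\,dx\,dt$ if $\alpha\ne1$. The noise $F=(F_1,\dots,F_n)$ is the centered Gaussian random linear functional with $E[F_i(f)F_j(g)]=\delta_{ij}Q(f,g)$, defined first for smooth compactly supported $f,g$ and extended to all functions $f$ with $Q(f,f)<\infty$. The stochastic integral $\int\int f(s,y)F(dy\,ds)$ means $F(f)$, an $\mathbf{R}^n$-valued Gaussian variable. The function $(s,y)\mapsto G(t-s,x-y)-G(-s,-y)$, restricted to $s\le t$, belongs to this class for every $t\ge0$, $x\in\mathbf{R}^N$, so $U(t,x)$ is defined. Fractional Brownian motion in $\mathbf{R}^n$ with Hurst parameter $H\in(0,1]$ is the process $(X_t)_{t\ge0}$ specified by: (1) $X_0=0$ with probability 1; (2) $X$ is a Gaussian process with stationary increments, i.e. for $t,h>0$ the distribution of $X_{t+h}-X_t$ does not depend on $t$; (3) for $c>0$, $X_{ct}\stackrel{\mathcal{D}}{=}c^HX_t$ (equality in distribution as processes in $t$); (4) $X_1$ has the standard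 normal distribution in $\mathbf{R}^n$. The components are independent; that is, $X$ is centered Gaussian with $E[X^i_sX^j_t]=\frac{\delta_{ij}}{2}\left(s^{2H}+t^{2H}-|t-s|^{2H}\right)$.
   Formalization: For α ≠ 1 the factor 2^{-3α/2+1} in the denominator of K_α is replaced by 2^{-α+1}; with the printed factor each component of X_1 has variance 2^{α/2}, which is not 1, so X_1 would not be standard normal. *)

theory Defs
  imports "HOL-Probability.Probability"
begin

definition heat_kernel :: "real \<Rightarrow> real ^ 'N \<Rightarrow> real" where
  "heat_kernel t x =
     (if t > 0 then (4 * pi * t) powr (- (real CARD('N) / 2)) * exp (- (norm x)\<^sup>2 / (4 * t)) else 0)"

definition noise_cov ::
  "real \<Rightarrow> (real \<Rightarrow> real ^ 'N \<Rightarrow> real) \<Rightarrow> (real \<Rightarrow> real ^ 'N \<Rightarrow> real) \<Rightarrow> real" where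
  "noise_cov \<alpha> f g =
     (if \<alpha> = 1
      then (LINT t|lborel. LINT x|lborel. f t x * g t x)
      else (LINT t|lborel. LINT x|lborel. LINT y|lborel. f t x * g t y * norm (x - y) powr (- \<alpha>)))"

(* The class Q(f,f) < \<infinity>, read as absolute convergence of the integral defining Q(f,f).
   The Bochner integral of a non-integrable function is 0, so convergence has to be
   required separately from the value noise_cov \<alpha> f f. *)
definition noise_dom :: "real \<Rightarrow> (real \<Rightarrow> real ^ 'N \<Rightarrow> real) set" where
  "noise_dom \<alpha> =
     {f. case_prod f \<in> borel_measurable borel \<and>
         (if \<alpha> = 1
          then integrable lborel (\<lambda>(t, x). f t x * f t x)
          else integrable lborel (\<lambda>(t, x, y). f t x * f t y * norm (x - y) powr (- \<alpha>)))}"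

(* Point masses count as (degenerate) Gaussians. *)
definition gaussian_rv :: "'w measure \<Rightarrow> ('w \<Rightarrow> real) \<Rightarrow> bool" where
  "gaussian_rv M Y \<longleftrightarrow>
     Y \<in> borel_measurable M \<and>
     ((\<exists>\<mu>. AE \<omega> in M. Y \<omega> = \<mu>) \<or>
      (\<exists>\<mu> \<sigma>. \<sigma> > 0 \<and> distributed M lborel Y (\<lambda>y. ennreal (normal_density \<mu> \<sigma> y))))"

definition gaussian_family :: "'w measure \<Rightarrow> 'k set \<Rightarrow> ('k \<Rightarrow> 'w \<Rightarrow> real) \<Rightarrow> bool" where
  "gaussian_family M K Y \<longleftrightarrow>
     (\<forall>J c. finite J \<and> J \<subseteq> K \<longrightarrow> gaussian_rv M (\<lambda>\<omega>. \<Sum>k\<in>J. c k * Y k \<omega>))"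

(* Linearity holds almost surely for each choice of f, g, a, b, as usual for a random linear
   functional. Requiring the covariance on all of noise_dom makes F the L2-continuous extension
   of its restriction to smooth compactly supported functions. *)
definition gaussian_noise ::
  "'w measure \<Rightarrow> real \<Rightarrow> ((real \<Rightarrow> real ^ 'N \<Rightarrow> real) \<Rightarrow> 'w \<Rightarrow> real ^ 'n) \<Rightarrow> bool" where
  "gaussian_noise M \<alpha> F \<longleftrightarrow>
     (\<forall>f\<in>noise_dom \<alpha>. F f \<in> borel_measurable M) \<and>
     (\<forall>f\<in>noise_dom \<alpha>. \<forall>g\<in>noise_dom \<alpha>. \<forall>a b.
        AE \<omega> in M. F (\<lambda>t x. a * f t x + b * g t x) \<omega> = a *\<^sub>R F f \<omega> + b *\<^sub>R F g \<omega>) \<and>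
     gaussian_family M (noise_dom \<alpha> \<times> UNIV) (\<lambda>(f, i) \<omega>. F f \<omega> $ i) \<and>
     (\<forall>f\<in>noise_dom \<alpha>. \<forall>i. (LINT \<omega>|M. F f \<omega> $ i) = 0) \<and>
     (\<forall>f\<in>noise_dom \<alpha>. \<forall>g\<in>noise_dom \<alpha>. \<forall>i j.
        (LINT \<omega>|M. F f \<omega> $ i * F g \<omega> $ j) = (if i = j then noise_cov \<alpha> f g else 0))"

definition pinned_string ::
  "((real \<Rightarrow> real ^ 'N \<Rightarrow> real) \<Rightarrow> 'w \<Rightarrow> real ^ 'n) \<Rightarrow> real \<Rightarrow> real ^ 'N \<Rightarrow> 'w \<Rightarrow> real ^ 'n" where
  "pinned_string F t x =
     F (\<lambda>s y. if s \<le> t then heat_kernel (t - s) (x - y) - heat_kernel (- s) (- y) else 0)"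

(* For \<alpha> \<noteq> 1 the literature has the factor 2 powr (- 3 * \<alpha> / 2 + 1) in the denominator, which
   is a slip: it normalises only the contribution of the noise on 0 < s < t. Every component of
   U(t,0) has variance
     2 powr (1 - \<alpha>) * Gamma((N-\<alpha>)/2) / ((2-\<alpha>) * Gamma(N/2)) * t powr ((2-\<alpha>)/2),
   so that X_1 is standard normal only with the factor 2 powr (- \<alpha> + 1). *)
definition string_const :: "nat \<Rightarrow> real \<Rightarrow> real" where
  "string_const N \<alpha> =
     (if \<alpha> = 1
      then 2 powr (- 1 / 2) * (4 * pi) powr (real N / 4)
      else sqrt (((2 - \<alpha>) * Gamma (real N / 2)) /
                 (2 powr (- \<alpha> + 1) * Gamma ((real N - \<alpha>) / 2))))"

(* Only the values X t with t \<ge> 0 matter. Self-similarity is equality of the laws of the whole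
   processes, on the product sigma-algebra over the time set {0..}. The last clause is the
   independence of the components, in its covariance form; "standard normal in R^n" is given by
   the product density. *)
definition fractional_brownian_motion ::
  "'w measure \<Rightarrow> real \<Rightarrow> (real \<Rightarrow> 'w \<Rightarrow> real ^ 'n) \<Rightarrow> bool" where
  "fractional_brownian_motion M H X \<longleftrightarrow>
     0 < H \<and> H \<le> 1 \<and>
     (\<forall>t\<ge>0. X t \<in> borel_measurable M) \<and>
     (AE \<omega> in M. X 0 \<omega> = 0) \<and>
     gaussian_family M ({0..} \<times> UNIV) (\<lambda>(t, i) \<omega>. X t \<omega> $ i) \<and>
     (\<forall>h>0. \<forall>t>0. \<forall>t'>0.
        distr M borel (\<lambda>\<omega>. X (t + h) \<omega> - X t \<omega>) = distr M borel (\<lambda>\<omega>. X (t' + h) \<omega> - X t' \<omega>)) \<and>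
     (\<forall>c>0.
        distr M (PiM {0..} (\<lambda>_. borel)) (\<lambda>\<omega>. \<lambda>t\<in>{0..}. X (c * t) \<omega>) =
        distr M (PiM {0..} (\<lambda>_. borel)) (\<lambda>\<omega>. \<lambda>t\<in>{0..}. (c powr H) *\<^sub>R X t \<omega>)) \<and>
     distributed M lborel (X 1) (\<lambda>z. ennreal (\<Prod>i\<in>UNIV. std_normal_density (z $ i))) \<and>
     (\<forall>t\<ge>0. \<forall>i. (LINT \<omega>|M. X t \<omega> $ i) = 0) \<and>
     (\<forall>s\<ge>0. \<forall>t\<ge>0. \<forall>i j.
        (LINT \<omega>|M. X s \<omega> $ i * X t \<omega> $ j) =
        (if i = j then (s powr (2 * H) + t powr (2 * H) - \<bar>t - s\<bar> powr (2 * H)) / 2 else 0))"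

end

theory Submission
  imports Defs "HOL-Real_Asymp.Real_Asymp"
begin

text \<open>
  Everything is Gaussian, so it suffices to compute covariances: if two centered Gaussian families
  have the same covariance then the laws on the product space agree. This is reduced to Levy's
  one-dimensional uniqueness theorem by replacing the coordinates one at a time, passing from
  \<open>E[\<Prod>\<^sub>I 1(X\<^sub>i \<in> A\<^sub>i) cos(\<Sum>\<^sub>J c\<^sub>k X\<^sub>k + d)]\<close> for \<open>I, J \<union> {k}\<close> to the same for \<open>I \<union> {k}, J\<close>.

  For the covariance, write \<open>|z|\<close> to the power \<open>-\<alpha>\<close> as \<open>1/\<Gamma>(\<alpha>/2)\<close> times the integral of
  \<open>l powr (\<alpha>/2 - 1) * exp(-l|z|\<^sup>2)\<close> over \<open>l > 0\<close>. The spatial integrals become Gaussian, and a Beta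
  integral gives \<open>Q(G(a), G(b)) = C (a + b) powr (-\<alpha>/2)\<close> on a time slice. So the covariance of
  \<open>U(s,0)\<close> and \<open>U(t,0)\<close> is the integral over \<open>u\<close> of a second difference of a power function,
  which telescopes: the contributions \<open>(s + t) powr (1 - \<alpha>/2)\<close> of \<open>u < 0\<close> and of \<open>0 < u < s\<close> cancel.
\<close>

section \<open>Laws of Gaussian families\<close>

text \<open>The covariance formula leaves two difficulties. Membership in \<open>noise_dom\<close>
  is absolute convergence, whereas the pinned kernel changes sign and its covariance is computed
  with cancellation, so a positive majorant is needed as well. On the time slice \<open>u\<close> a
  single kernel \<open>heat_kernel (- u)\<close> has squared norm of order
  \<open>(- u) powr (- (\<alpha> / 2))\<close>, which is not integrable at minus infinity because
  \<alpha> < 2. Only the pinning helps: the difference of two heat kernels whose times differ by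
  \<open>t\<close> gains a factor \<open>t / (- u)\<close>, hence \<open>1 / u\<^sup>2\<close> in
  the square. This bound is again a combination of heat kernels, so the explicit slice formula
  evaluates its norm too. The other difficulty is the density of \<open>X 1\<close>, which comes
  from the same comparison of laws: the coordinates of \<open>X 1\<close> are compared with those of
  a product of standard normal measures, whose density is known.\<close>

lemma weighted_distr:
  fixes Y V :: "'a \<Rightarrow> real"
  assumes "prob_space N" and [measurable]: "Y \<in> borel_measurable N" "V \<in> borel_measurable N"
    and V: "\<And>\<omega>. 0 \<le> V \<omega>" "\<And>\<omega>. V \<omega> \<le> B" and mV: "m = (LINT \<omega>|N. V \<omega>)" and m: "m > 0"
    and [measurable]: "A \<in> sets borel"
  defines "\<nu> \<equiv> distr (density N (\<lambda>\<omega>. ennreal (V \<omega> / m))) borel Y"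
  shows "real_distribution \<nu>"
    and "char \<nu> a = complex_of_real ((LINT \<omega>|N. V \<omega> * cos (a * Y \<omega> + 0)) / m)
      + \<i> * complex_of_real ((LINT \<omega>|N. V \<omega> * cos (a * Y \<omega> + (- (pi/2)))) / m)"
    and "measure \<nu> A = (LINT \<omega>|N. V \<omega> * indicator A (Y \<omega>)) / m"
proof -
  interpret N: prob_space N by fact
  have intV: "integrable N V"
    by (rule N.integrable_const_bound[of _ B]) (use V in auto)
  have nn: "(\<integral>\<^sup>+\<omega>. ennreal (V \<omega> / m) \<partial>N) = 1"
    using intV V m by (subst nn_integral_eq_integral) (auto simp: mV[symmetric])
  then have p: "prob_space (density N (\<lambda>\<omega>. ennreal (V \<omega> / m)))"
    by (intro prob_spaceI) (simp add: emeasure_density)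
  interpret D: prob_space "density N (\<lambda>\<omega>. ennreal (V \<omega> / m))" by fact
  have p2: "prob_space \<nu>"
    unfolding \<nu>_def by (rule D.prob_space_distr) simp
  then have 1: "real_distribution \<nu>"
    by (simp add: real_distribution_def real_distribution_axioms_def \<nu>_def)
  have 2: "char \<nu> a = complex_of_real ((LINT \<omega>|N. V \<omega> * cos (a * Y \<omega> + 0)) / m)
             + \<i> * complex_of_real ((LINT \<omega>|N. V \<omega> * cos (a * Y \<omega> + (- (pi/2)))) / m)" for a
  proof -
    have i: "integrable N (\<lambda>\<omega>. V \<omega> * cos (a * Y \<omega> + d))" for d
      by (rule N.integrable_const_bound[of _ B])
         (use V in \<open>auto simp: abs_mult intro!: AE_I2 mult_le_one order_trans[OF mult_left_le]\<close>)
    \<comment> \<open>A phase of \<open>- (pi/2)\<close> makes the real and the imaginary part of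
      the characteristic function members of one family of integrals, those of
      \<open>V \<omega> * cos (a * Y \<omega> + d)\<close>.\<close>
    have cs: "cos (x + - (pi/2)) = sin x" for x
      by (simp add: cos_diff)
    have ex: "iexp x = complex_of_real (cos x) + \<i> * complex_of_real (sin x)" for x
      by (simp add: exp_Euler cos_of_real sin_of_real)
    have "char \<nu> a = (CLINT \<omega>|N. (V \<omega> / m) *\<^sub>R iexp (a * Y \<omega>))"
      unfolding char_def \<nu>_def using V m
      by (subst integral_distr, simp_all, subst integral_density) auto
    also have "\<dots> = (CLINT \<omega>|N. complex_of_real (V \<omega> * cos (a * Y \<omega> + 0) / m)
          + \<i> * complex_of_real (V \<omega> * cos (a * Y \<omega> + (- (pi/2))) / m))"
      by (rule Bochner_Integration.integral_cong[OF refl])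
         (simp only: cs ex, simp add: scaleR_conv_of_real algebra_simps add_divide_distrib)
    also have "\<dots> = (CLINT \<omega>|N. complex_of_real (V \<omega> * cos (a * Y \<omega> + 0) / m))
          + (CLINT \<omega>|N. \<i> * complex_of_real (V \<omega> * cos (a * Y \<omega> + (- (pi/2))) / m))"
      by (intro Bochner_Integration.integral_add integrable_mult_right integrable_of_real
           integrable_divide_zero i)
    finally show ?thesis
      by (simp only: integral_mult_right_zero integral_complex_of_real integral_divide_zero)
  qed
  have 3: "measure \<nu> A = (LINT \<omega>|N. V \<omega> * indicator A (Y \<omega>)) / m"
  proof -
    have "measure \<nu> A = (LINT x|\<nu>. indicator A x)"
      by (simp add: \<nu>_def)
    also have "\<dots> = (LINT \<omega>|N. (V \<omega> / m) *\<^sub>R indicator A (Y \<omega>))"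
      unfolding \<nu>_def using V m
      by (subst integral_distr, simp_all, subst integral_density) auto
    finally show ?thesis by simp
  qed
  show "real_distribution \<nu>" "char \<nu> a = complex_of_real ((LINT \<omega>|N. V \<omega> * cos (a * Y \<omega> + 0)) / m)
      + \<i> * complex_of_real ((LINT \<omega>|N. V \<omega> * cos (a * Y \<omega> + (- (pi/2)))) / m)"
    "measure \<nu> A = (LINT \<omega>|N. V \<omega> * indicator A (Y \<omega>)) / m"
    by (fact 1 2 3)+
qed

text \<open>Divided by their common mass, the weights become densities of probability measures under
  which \<open>X\<close> and \<open>X'\<close> have the same characteristic function; the free phase
  \<open>d\<close> provides its imaginary part.\<close>

lemma weighted_Levy_uniqueness:
  fixes X W :: "'a \<Rightarrow> real" and X' W' :: "'b \<Rightarrow> real"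
  assumes "prob_space M" "prob_space M'"
    and [measurable]: "X \<in> borel_measurable M" "X' \<in> borel_measurable M'"
      "W \<in> borel_measurable M" "W' \<in> borel_measurable M'"
    and W: "\<And>\<omega>. 0 \<le> W \<omega>" "\<And>\<omega>. W \<omega> \<le> B" and W': "\<And>\<omega>. 0 \<le> W' \<omega>" "\<And>\<omega>. W' \<omega> \<le> B"
    and eq: "\<And>a d. (LINT \<omega>|M. W \<omega> * cos (a * X \<omega> + d)) = (LINT \<omega>|M'. W' \<omega> * cos (a * X' \<omega> + d))"
    and [measurable]: "A \<in> sets borel"
  shows "(LINT \<omega>|M. W \<omega> * indicator A (X \<omega>)) = (LINT \<omega>|M'. W' \<omega> * indicator A (X' \<omega>))"
proof -
  interpret M: prob_space M by fact
  interpret M': prob_space M' by fact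
  have intW: "integrable M W"
    by (rule M.integrable_const_bound[of _ B]) (use W in auto)
  have intW': "integrable M' W'"
    by (rule M'.integrable_const_bound[of _ B]) (use W' in auto)
  define m where "m = (LINT \<omega>|M. W \<omega>)"
  \<comment> \<open>At \<open>a = d = 0\<close> the cosine is 1 and the hypothesis compares the
    masses.\<close>
  have m': "m = (LINT \<omega>|M'. W' \<omega>)"
    using eq[of 0 0] by (simp add: m_def)
  have "m \<ge> 0" unfolding m_def using W by simp
  show ?thesis
  proof (cases "m = 0")
    \<comment> \<open>A weight of mass 0 cannot be normalised, but it vanishes almost
      surely.\<close>
    case True
    have "AE \<omega> in M. W \<omega> = 0"
      using True integral_nonneg_eq_0_iff_AE[OF intW] W by (simp add: m_def)
    then have "AE \<omega> in M. W \<omega> * indicator A (X \<omega>) = 0" by auto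
    then have 1: "(LINT \<omega>|M. W \<omega> * indicator A (X \<omega>)) = 0" by (rule integral_eq_zero_AE)
    have "AE \<omega> in M'. W' \<omega> = 0"
      using True integral_nonneg_eq_0_iff_AE[OF intW'] W' by (simp add: m')
    then have "AE \<omega> in M'. W' \<omega> * indicator A (X' \<omega>) = 0" by auto
    then have 2: "(LINT \<omega>|M'. W' \<omega> * indicator A (X' \<omega>)) = 0" by (rule integral_eq_zero_AE)
    show ?thesis using 1 2 by simp
  next
    case False
    with \<open>m \<ge> 0\<close> have m: "m > 0" by simp
    note r1 = weighted_distr[OF \<open>prob_space M\<close> assms(3,5) W m_def m \<open>A \<in> sets borel\<close>]
    note r2 = weighted_distr[OF \<open>prob_space M'\<close> assms(4,6) W' m' m \<open>A \<in> sets borel\<close>]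
    have "distr (density M (\<lambda>\<omega>. ennreal (W \<omega> / m))) borel X =
        distr (density M' (\<lambda>\<omega>. ennreal (W' \<omega> / m))) borel X'"
      by (intro Levy_uniqueness r1(1) r2(1) ext) (simp only: r1(2) r2(2) eq)
    with r1(3) r2(3) show ?thesis using m by (metis divide_cancel_right less_numeral_extra(3))
  qed
qed

text \<open>\<open>J\<close>, \<open>c\<close> and \<open>d\<close> stay arbitrary in the induction:
  to bring \<open>k\<close> into the box, the induction hypothesis is used for
  \<open>insert k J\<close> with every coefficient \<open>a\<close> of \<open>X k\<close>, and these
  are the frequencies that Levy's theorem asks for. Since \<open>I\<close> and \<open>J\<close> are
  disjoint, \<open>k\<close> is a new index and its coefficient is free.\<close>

lemma box_expectation_cong:
  fixes X :: "'k \<Rightarrow> 'a \<Rightarrow> real" and X' :: "'k \<Rightarrow> 'b \<Rightarrow> real"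
  assumes "prob_space M" "prob_space M'"
    and [measurable]: "\<And>k. k \<in> K \<Longrightarrow> X k \<in> borel_measurable M" "\<And>k. k \<in> K \<Longrightarrow> X' k \<in> borel_measurable M'"
    and eq: "\<And>J c d. finite J \<Longrightarrow> J \<subseteq> K \<Longrightarrow>
      (LINT \<omega>|M. cos ((\<Sum>k\<in>J. c k * X k \<omega>) + d)) = (LINT \<omega>|M'. cos ((\<Sum>k\<in>J. c k * X' k \<omega>) + d))"
    and "finite I" "I \<subseteq> K" "\<And>i. i \<in> I \<Longrightarrow> A i \<in> sets borel"
    and "finite J" "J \<subseteq> K" "I \<inter> J = {}"
  shows "(LINT \<omega>|M. (\<Prod>i\<in>I. indicator (A i) (X i \<omega>)) * cos ((\<Sum>k\<in>J. c k * X k \<omega>) + d)) =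
    (LINT \<omega>|M'. (\<Prod>i\<in>I. indicator (A i) (X' i \<omega>)) * cos ((\<Sum>k\<in>J. c k * X' k \<omega>) + d))"
  using assms(6-)
proof (induction I arbitrary: J c d rule: finite_induct)
  case empty
  then show ?case using eq by simp
next
  case (insert k I)
  interpret M: prob_space M by fact
  interpret M': prob_space M' by fact
  have [measurable]: "\<And>i. i \<in> I \<Longrightarrow> A i \<in> sets borel" "A k \<in> sets borel"
    "\<And>i. i \<in> I \<Longrightarrow> X i \<in> borel_measurable M" "\<And>i. i \<in> I \<Longrightarrow> X' i \<in> borel_measurable M'"
    "\<And>i. i \<in> J \<Longrightarrow> X i \<in> borel_measurable M" "\<And>i. i \<in> J \<Longrightarrow> X' i \<in> borel_measurable M'"
    "X k \<in> borel_measurable M" "X' k \<in> borel_measurable M'"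
    using insert.prems assms(3,4) by auto
  have kJ: "k \<notin> J" using insert.prems by auto
  let ?P = "\<lambda>\<omega>. \<Prod>i\<in>I. indicator (A i) (X i \<omega>) :: real"
  let ?P' = "\<lambda>\<omega>. \<Prod>i\<in>I. indicator (A i) (X' i \<omega>) :: real"
  let ?S = "\<lambda>J c \<omega>. \<Sum>k\<in>J. c k * X k \<omega>"
  let ?S' = "\<lambda>J c \<omega>. \<Sum>k\<in>J. c k * X' k \<omega>"
  have P: "0 \<le> ?P \<omega>" "?P \<omega> \<le> 1" for \<omega> by (auto intro!: prod_nonneg prod_le_1)
  have P': "0 \<le> ?P' \<omega>" "?P' \<omega> \<le> 1" for \<omega> by (auto intro!: prod_nonneg prod_le_1)
  have bound: "norm (p * cos x) \<le> 1" "norm (p * indicator B y * cos x) \<le> 1"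
    "norm (p * indicator B y) \<le> 1"
    if "0 \<le> p" "p \<le> 1" for p x y :: real and B
    using that by (auto simp: abs_mult indicator_def intro!: mult_le_one)
  have IH: "(LINT \<omega>|M. ?P \<omega> * cos (?S L c \<omega> + d)) = (LINT \<omega>|M'. ?P' \<omega> * cos (?S' L c \<omega> + d))"
    if "finite L" "L \<subseteq> K" "I \<inter> L = {}" for L c d
    using insert.IH[of L c d] insert.prems that by auto
  have fin: "finite (insert k J)" "insert k J \<subseteq> K" "I \<inter> insert k J = {}"
    using insert by auto
  have IHk: "(LINT \<omega>|M. ?P \<omega> * cos (?S J c \<omega> + a * X k \<omega> + d)) =
      (LINT \<omega>|M'. ?P' \<omega> * cos (?S' J c \<omega> + a * X' k \<omega> + d))" for c d a
  proof -
    have 1: "?S (insert k J) (c(k := a)) \<omega> = ?S J c \<omega> + a * X k \<omega>" for \<omega>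
      using kJ insert.prems(3) by (auto intro!: sum.cong)
    have 2: "?S' (insert k J) (c(k := a)) \<omega> = ?S' J c \<omega> + a * X' k \<omega>" for \<omega>
      using kJ insert.prems(3) by (auto intro!: sum.cong)
    show ?thesis using IH[OF fin, of "c(k := a)" d] unfolding 1 2 .
  qed
  have i: "integrable M (\<lambda>\<omega>. ?P \<omega> * cos (?S J c \<omega> + a * X k \<omega> + d))"
     "integrable M (\<lambda>\<omega>. ?P \<omega> * cos (a * X k \<omega> + d))"
     "integrable M (\<lambda>\<omega>. ?P \<omega> * indicator (A k) (X k \<omega>) * cos (?S J c \<omega> + d))"
     "integrable M (\<lambda>\<omega>. ?P \<omega> * indicator (A k) (X k \<omega>))" for a c d
    by (rule M.integrable_const_bound[of _ 1]; use bound[OF P] in simp)+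
  have i': "integrable M' (\<lambda>\<omega>. ?P' \<omega> * cos (?S' J c \<omega> + a * X' k \<omega> + d))"
     "integrable M' (\<lambda>\<omega>. ?P' \<omega> * cos (a * X' k \<omega> + d))"
     "integrable M' (\<lambda>\<omega>. ?P' \<omega> * indicator (A k) (X' k \<omega>) * cos (?S' J c \<omega> + d))"
     "integrable M' (\<lambda>\<omega>. ?P' \<omega> * indicator (A k) (X' k \<omega>))" for a c d
    by (rule M'.integrable_const_bound[of _ 1]; use bound[OF P'] in simp)+
  have e1: "(LINT \<omega>|M. ?P \<omega> * cos (a * X k \<omega> + d)) = (LINT \<omega>|M'. ?P' \<omega> * cos (a * X' k \<omega> + d))" for a d
    using IHk[of "\<lambda>_. 0" a d] by simp
  \<comment> \<open>The product-to-sum formula, arranged so that both resulting cosines are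
    instances of \<open>IHk\<close>, with the frequencies \<open>a\<close> and
    \<open>- a\<close>.\<close>
  have id: "p * (1 + cos (s + d)) * cos (y + e) =
      p * cos (y + e) + (p * cos (s + y + (d + e)) / 2 + p * cos (s + - y + (d - e)) / 2)"
    for p s d y e :: real
  proof -
    have "cos (s + d) * cos (y + e) = (cos (s + y + (d + e)) + cos (s + - y + (d - e))) / 2"
      unfolding cos_times_cos by (simp add: algebra_simps)
    then show ?thesis by (simp add: distrib_left distrib_right mult.assoc add_divide_distrib)
  qed
  have e2: "(LINT \<omega>|M. (?P \<omega> * (1 + cos (?S J c \<omega> + d))) * cos (a * X k \<omega> + e)) =
      (LINT \<omega>|M'. (?P' \<omega> * (1 + cos (?S' J c \<omega> + d))) * cos (a * X' k \<omega> + e))" for a e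
    \<comment> \<open>Levy's theorem needs a nonnegative weight, hence \<open>1 + cos\<close> in place of \<open>cos\<close>.\<close>
    unfolding id using i(1)[of _ "- a"] i'(1)[of _ "- a"] i(1,2) i'(1,2) IHk[of _ "- a"]
    by (simp add: e1 IHk)
  have "(LINT \<omega>|M. (?P \<omega> * (1 + cos (?S J c \<omega> + d))) * indicator (A k) (X k \<omega>)) =
      (LINT \<omega>|M'. (?P' \<omega> * (1 + cos (?S' J c \<omega> + d))) * indicator (A k) (X' k \<omega>))"
  proof (rule weighted_Levy_uniqueness[OF assms(1,2), where B = 2])
    show "?P \<omega> * (1 + cos (?S J c \<omega> + d)) \<le> 2" for \<omega>
      using P[of \<omega>] mult_mono[of "?P \<omega>" 1 "1 + cos (?S J c \<omega> + d)" 2]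
        cos_ge_minus_one[of "?S J c \<omega> + d"] by simp
    show "?P' \<omega> * (1 + cos (?S' J c \<omega> + d)) \<le> 2" for \<omega>
      using P'[of \<omega>] mult_mono[of "?P' \<omega>" 1 "1 + cos (?S' J c \<omega> + d)" 2]
        cos_ge_minus_one[of "?S' J c \<omega> + d"] by simp
    show "0 \<le> ?P \<omega> * (1 + cos (?S J c \<omega> + d))" for \<omega>
      using cos_ge_minus_one[of "?S J c \<omega> + d"] by (intro mult_nonneg_nonneg P) linarith
    show "0 \<le> ?P' \<omega> * (1 + cos (?S' J c \<omega> + d))" for \<omega>
      using cos_ge_minus_one[of "?S' J c \<omega> + d"] by (intro mult_nonneg_nonneg P') linarith
  qed (use e2 in auto)
  \<comment> \<open>The comparison with the indicator product alone as weight; subtracting it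
    removes the summand 1 from \<open>1 + cos\<close>.\<close>
  moreover have "(LINT \<omega>|M. ?P \<omega> * indicator (A k) (X k \<omega>)) = (LINT \<omega>|M'. ?P' \<omega> * indicator (A k) (X' k \<omega>))"
    by (rule weighted_Levy_uniqueness[OF assms(1,2), where B = 1]) (use P P' e1 in auto)
  moreover have "p * (1 + s) * y = p * y + p * y * s" for p s y :: real
    by (simp add: algebra_simps)
  ultimately have "(LINT \<omega>|M. ?P \<omega> * indicator (A k) (X k \<omega>) * cos (?S J c \<omega> + d)) =
      (LINT \<omega>|M'. ?P' \<omega> * indicator (A k) (X' k \<omega>) * cos (?S' J c \<omega> + d))"
    using i(3,4) i'(3,4) by simp
  then show ?case
    using insert.hyps by (simp add: ac_simps)
qed

text \<open>\<open>K\<close> may be uncountable, as the time set of a process is: finite-dimensional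
  boxes generate the product sigma-algebra and are stable under intersection. The probability of a
  box is the case of empty \<open>J\<close> and \<open>d = 0\<close> of the preceding result, where
  the cosine is 1.\<close>

lemma distr_PiM_cong:
  fixes X :: "'k \<Rightarrow> 'a \<Rightarrow> real" and X' :: "'k \<Rightarrow> 'b \<Rightarrow> real"
  assumes "prob_space M" "prob_space M'"
    and [measurable]: "\<And>k. k \<in> K \<Longrightarrow> X k \<in> borel_measurable M" "\<And>k. k \<in> K \<Longrightarrow> X' k \<in> borel_measurable M'"
    and eq: "\<And>J c d. finite J \<Longrightarrow> J \<subseteq> K \<Longrightarrow>
      (LINT \<omega>|M. cos ((\<Sum>k\<in>J. c k * X k \<omega>) + d)) = (LINT \<omega>|M'. cos ((\<Sum>k\<in>J. c k * X' k \<omega>) + d))"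
  shows "distr M (PiM K (\<lambda>_. borel)) (\<lambda>\<omega>. \<lambda>k\<in>K. X k \<omega>) =
    distr M' (PiM K (\<lambda>_. borel)) (\<lambda>\<omega>. \<lambda>k\<in>K. X' k \<omega>)"
proof (rule measure_eqI_PiM_infinite)
  interpret M: prob_space M by fact
  interpret M': prob_space M' by fact
  interpret D: prob_space "distr M (PiM K (\<lambda>_. borel)) (\<lambda>\<omega>. \<lambda>k\<in>K. X k \<omega>)"
    by (rule M.prob_space_distr) simp
  show "finite_measure (distr M (PiM K (\<lambda>_. borel)) (\<lambda>\<omega>. \<lambda>k\<in>K. X k \<omega>))"
    by (rule D.finite_measure_axioms)
  fix A J assume J: "finite J" "J \<subseteq> K" and A: "\<And>i. i \<in> J \<Longrightarrow> A i \<in> sets (borel :: real measure)"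
  have *: "emeasure (distr N (PiM K (\<lambda>_. borel)) (\<lambda>\<omega>. \<lambda>k\<in>K. Y k \<omega>)) (prod_emb K (\<lambda>_. borel) J (Pi\<^sub>E J A)) =
      ennreal (LINT \<omega>|N. (\<Prod>i\<in>J. indicator (A i) (Y i \<omega>)))"
    if "prob_space N" and Y: "\<And>k. k \<in> K \<Longrightarrow> Y k \<in> borel_measurable N" for N :: "'c measure" and Y
  proof -
    interpret N: prob_space N by fact
    have [measurable]: "(\<lambda>\<omega>. \<lambda>k\<in>K. Y k \<omega>) \<in> measurable N (PiM K (\<lambda>_. borel))"
      using Y by measurable
    let ?E = "prod_emb K (\<lambda>_. borel) J (Pi\<^sub>E J A)"
    have [measurable]: "?E \<in> sets (PiM K (\<lambda>_. borel))"
      using J A by (intro sets_PiM_I) auto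
    have "emeasure (distr N (PiM K (\<lambda>_. borel)) (\<lambda>\<omega>. \<lambda>k\<in>K. Y k \<omega>)) ?E =
       ennreal (measure N ((\<lambda>\<omega>. \<lambda>k\<in>K. Y k \<omega>) -` ?E \<inter> space N))"
      by (simp add: emeasure_distr N.emeasure_eq_measure)
    also have "measure N ((\<lambda>\<omega>. \<lambda>k\<in>K. Y k \<omega>) -` ?E \<inter> space N) =
       (LINT \<omega>|N. indicator ((\<lambda>\<omega>. \<lambda>k\<in>K. Y k \<omega>) -` ?E \<inter> space N) \<omega>)"
      by simp
    also have "\<dots> = (LINT \<omega>|N. (\<Prod>i\<in>J. indicator (A i) (Y i \<omega>)))"
    proof (rule Bochner_Integration.integral_cong[OF refl])
      fix \<omega> assume "\<omega> \<in> space N"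
      moreover have "(\<lambda>k\<in>K. Y k \<omega>) \<in> ?E \<longleftrightarrow> (\<forall>i\<in>J. Y i \<omega> \<in> A i)"
        using J by (auto simp: prod_emb_def PiE_iff)
      ultimately show "indicator ((\<lambda>\<omega>. \<lambda>k\<in>K. Y k \<omega>) -` ?E \<inter> space N) \<omega> =
          (\<Prod>i\<in>J. indicator (A i) (Y i \<omega>) :: real)"
        using J(1) by (auto simp: indicator_def prod_zero_iff)
    qed
    finally show ?thesis .
  qed
  have "(LINT \<omega>|M. (\<Prod>i\<in>J. indicator (A i) (X i \<omega>) :: real)) = (LINT \<omega>|M'. (\<Prod>i\<in>J. indicator (A i) (X' i \<omega>)))"
    using box_expectation_cong[OF assms(1-5) J A, where J = "{}" and d = 0] by simp
  then show "emeasure (distr M (PiM K (\<lambda>_. borel)) (\<lambda>\<omega>. \<lambda>k\<in>K. X k \<omega>)) (prod_emb K (\<lambda>_. borel) J (Pi\<^sub>E J A)) =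
     emeasure (distr M' (PiM K (\<lambda>_. borel)) (\<lambda>\<omega>. \<lambda>k\<in>K. X' k \<omega>)) (prod_emb K (\<lambda>_. borel) J (Pi\<^sub>E J A))"
    by (simp add: *[OF assms(1,3)] *[OF assms(2,4)])
qed simp_all

section \<open>Characteristic functions of centered Gaussian families\<close>

lemma (in prob_space) expectation_cos_char:
  assumes [measurable]: "Y \<in> borel_measurable M"
  shows "expectation (\<lambda>\<omega>. cos (Y \<omega> + d)) = Re (iexp d * char (distr M borel Y) 1)"
proof -
  have i: "integrable M (\<lambda>\<omega>. iexp (Y \<omega>))"
    by (rule integrable_const_bound[of _ 1]) auto
  have "iexp d * char (distr M borel Y) 1 = (CLINT \<omega>|M. iexp d * iexp (Y \<omega>))"
    by (simp add: char_def integral_distr)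
  also have "\<dots> = (CLINT \<omega>|M. iexp (Y \<omega> + d))"
    by (simp add: exp_add[symmetric] distrib_left add.commute)
  finally have "Re (iexp d * char (distr M borel Y) 1) = Re (CLINT \<omega>|M. iexp (Y \<omega> + d))"
    by simp
  also have "\<dots> = (LINT \<omega>|M. Re (iexp (Y \<omega> + d)))"
    by (rule integral_Re[symmetric], rule integrable_const_bound[of _ 1]) auto
  finally show ?thesis by (simp add: Re_exp)
qed

text \<open>Both forms of \<open>gaussian_rv\<close> obey one formula: a point mass of mean 0 sits
  at 0 and has variance 0, and a normal variable becomes standard after division by
  \<open>\<sigma>\<close>. Integrability is derived from the Gaussian law, since the value 0 of a
  Bochner integral does not imply it.\<close>

lemma (in prob_space) centered_gaussian_rv:
  assumes Y: "gaussian_rv M Y" and mean: "expectation Y = 0"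
  shows "integrable M Y" "integrable M (\<lambda>\<omega>. (Y \<omega>)\<^sup>2)"
    "expectation (\<lambda>\<omega>. cos (Y \<omega> + d)) = cos d * exp (- expectation (\<lambda>\<omega>. (Y \<omega>)\<^sup>2) / 2)"
proof -
  have m[measurable]: "Y \<in> borel_measurable M" using Y by (simp add: gaussian_rv_def)
  consider (c) \<mu> where "AE \<omega> in M. Y \<omega> = \<mu>"
    | (n) \<mu> \<sigma> where "\<sigma> > 0" "distributed M lborel Y (\<lambda>y. ennreal (normal_density \<mu> \<sigma> y))"
    using Y unfolding gaussian_rv_def by blast
  then have "integrable M Y \<and> integrable M (\<lambda>\<omega>. (Y \<omega>)\<^sup>2) \<and>
    expectation (\<lambda>\<omega>. cos (Y \<omega> + d)) = cos d * exp (- expectation (\<lambda>\<omega>. (Y \<omega>)\<^sup>2) / 2)"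
  proof cases
    case c
    have "expectation Y = expectation (\<lambda>_. \<mu>)" by (rule integral_cong_AE) (use c in auto)
    then have "\<mu> = 0" using mean by (simp add: prob_space)
    with c have c: "AE \<omega> in M. Y \<omega> = 0" by simp
    have "integrable M Y" by (subst integrable_cong_AE[of _ _ "\<lambda>_. 0"]) (use c in auto)
    moreover have "integrable M (\<lambda>\<omega>. (Y \<omega>)\<^sup>2)"
      by (subst integrable_cong_AE[of _ _ "\<lambda>_. 0"]) (use c in auto)
    moreover have "expectation (\<lambda>\<omega>. (Y \<omega>)\<^sup>2) = expectation (\<lambda>_. 0)"
      by (rule integral_cong_AE) (use c in auto)
    moreover have "expectation (\<lambda>\<omega>. cos (Y \<omega> + d)) = expectation (\<lambda>_. cos d)"
      by (rule integral_cong_AE) (use c in auto)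
    ultimately show ?thesis by (simp add: prob_space)
  next
    case n
    have "\<mu> = 0" using normal_distributed_expectation[OF n] mean by simp
    with n have D: "distributed M lborel Y (\<lambda>y. ennreal (normal_density 0 \<sigma> y))" by simp
    have "integrable M Y"
      using integrable_normal_moment[OF n(1), of 0 1]
      by (subst distributed_integrable[OF D, symmetric]) auto
    moreover have "integrable M (\<lambda>\<omega>. (Y \<omega>)\<^sup>2)"
      using integrable_normal_moment[OF n(1), of 0 2]
      by (subst distributed_integrable[OF D, symmetric]) auto
    moreover have var: "expectation (\<lambda>\<omega>. (Y \<omega>)\<^sup>2) = \<sigma>\<^sup>2"
      using normal_distributed_variance[OF n(1) D] mean by simp
    moreover have "char (distr M borel Y) 1 = exp (- expectation (\<lambda>\<omega>. (Y \<omega>)\<^sup>2) / 2)"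
    proof -
      have "distributed M lborel (\<lambda>\<omega>. Y \<omega> / \<sigma>) std_normal_density"
        using normal_standard_normal_convert[OF n(1), of Y 0] D by simp
      then have "distr M lborel (\<lambda>\<omega>. Y \<omega> / \<sigma>) = std_normal_distribution"
        by (simp add: distributed_def)
      moreover have "distr M lborel (\<lambda>\<omega>. Y \<omega> / \<sigma>) = distr M borel (\<lambda>\<omega>. Y \<omega> / \<sigma>)"
        by (rule distr_cong) auto
      ultimately have "char (distr M borel (\<lambda>\<omega>. Y \<omega> / \<sigma>)) \<sigma> = exp (- \<sigma>\<^sup>2 / 2)"
        by (simp add: char_std_normal_distribution)
      moreover have "char (distr M borel (\<lambda>\<omega>. Y \<omega> / \<sigma>)) \<sigma> = char (distr M borel Y) 1"
        using n(1) by (simp add: char_def integral_distr)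
      ultimately show ?thesis by (simp add: var)
    qed
    ultimately show ?thesis
      by (simp add: expectation_cos_char Re_exp)
  qed
  then show "integrable M Y" "integrable M (\<lambda>\<omega>. (Y \<omega>)\<^sup>2)"
    "expectation (\<lambda>\<omega>. cos (Y \<omega> + d)) = cos d * exp (- expectation (\<lambda>\<omega>. (Y \<omega>)\<^sup>2) / 2)"
    by auto
qed

lemma gaussian_family_rv:
  assumes "gaussian_family M K X" "k \<in> K"
  shows "gaussian_rv M (X k)"
  using assms unfolding gaussian_family_def
  by (elim allE[of _ "{k}"] allE[of _ "\<lambda>_. 1"]) simp

lemma (in prob_space) gaussian_family_integrable:
  assumes "gaussian_family M K X" "\<And>k. k \<in> K \<Longrightarrow> expectation (X k) = 0"
  shows "k \<in> K \<Longrightarrow> integrable M (X k)"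
    "k \<in> K \<Longrightarrow> l \<in> K \<Longrightarrow> integrable M (\<lambda>\<omega>. X k \<omega> * X l \<omega>)"
proof -
  have sq: "integrable M (X k)" "integrable M (\<lambda>\<omega>. (X k \<omega>)\<^sup>2)" if "k \<in> K" for k
    by (rule centered_gaussian_rv(1,2)[OF gaussian_family_rv[OF assms(1) that] assms(2)[OF that]])+
  show "k \<in> K \<Longrightarrow> integrable M (X k)" by (rule sq)
  assume k: "k \<in> K" and l: "l \<in> K"
  have [measurable]: "X k \<in> borel_measurable M" "X l \<in> borel_measurable M"
    using gaussian_family_rv[OF assms(1)] k l by (auto simp: gaussian_rv_def)
  have "integrable M (\<lambda>\<omega>. (X k \<omega>)\<^sup>2 + (X l \<omega>)\<^sup>2)"
    by (intro Bochner_Integration.integrable_add sq k l)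
  then show "integrable M (\<lambda>\<omega>. X k \<omega> * X l \<omega>)"
  proof (rule Bochner_Integration.integrable_bound)
    have "\<bar>x * y\<bar> \<le> x\<^sup>2 + y\<^sup>2" for x y :: real
      using sum_squares_bound[of "\<bar>x\<bar>" "\<bar>y\<bar>"] mult_nonneg_nonneg[of "\<bar>x\<bar>" "\<bar>y\<bar>"]
      by (simp add: abs_mult del: mult_nonneg_nonneg)
    then show "AE \<omega> in M. norm (X k \<omega> * X l \<omega>) \<le> norm ((X k \<omega>)\<^sup>2 + (X l \<omega>)\<^sup>2)"
      by simp
  qed simp
qed

text \<open>The right-hand side sees the family through its covariances only. The phase splits off
  as \<open>cos d\<close> because the characteristic function of a centered Gaussian variable is
  real.\<close>

lemma (in prob_space) gaussian_family_expectation_cos: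
  assumes X: "gaussian_family M K X" "\<And>k. k \<in> K \<Longrightarrow> expectation (X k) = 0"
    and J: "finite J" "J \<subseteq> K"
  shows "expectation (\<lambda>\<omega>. cos ((\<Sum>k\<in>J. c k * X k \<omega>) + d)) =
    cos d * exp (- (\<Sum>k\<in>J. \<Sum>l\<in>J. c k * c l * expectation (\<lambda>\<omega>. X k \<omega> * X l \<omega>)) / 2)"
proof -
  note int = gaussian_family_integrable[OF X]
  have "gaussian_rv M (\<lambda>\<omega>. \<Sum>k\<in>J. c k * X k \<omega>)"
    using X(1) J by (auto simp: gaussian_family_def)
  moreover have "expectation (\<lambda>\<omega>. \<Sum>k\<in>J. c k * X k \<omega>) = (\<Sum>k\<in>J. c k * expectation (X k))"
    using int(1) J by (subst Bochner_Integration.integral_sum) (auto simp: subset_iff)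
  then have "expectation (\<lambda>\<omega>. \<Sum>k\<in>J. c k * X k \<omega>) = 0"
    using X(2) J by (simp add: subset_iff)
  moreover have "expectation (\<lambda>\<omega>. (\<Sum>k\<in>J. c k * X k \<omega>)\<^sup>2) =
     expectation (\<lambda>\<omega>. \<Sum>k\<in>J. \<Sum>l\<in>J. c k * c l * (X k \<omega> * X l \<omega>))"
    by (simp add: power2_eq_square sum_product mult_ac)
  moreover have "\<dots> = (\<Sum>k\<in>J. \<Sum>l\<in>J. c k * c l * expectation (\<lambda>\<omega>. X k \<omega> * X l \<omega>))"
  proof -
    have [intro]: "integrable M (\<lambda>\<omega>. c k * c l * (X k \<omega> * X l \<omega>))" if "k \<in> J" "l \<in> J" for k l
      using int(2) J that by auto
    show ?thesis
      by (subst Bochner_Integration.integral_sum, rule Bochner_Integration.integrable_sum, blast,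
        intro sum.cong refl, subst Bochner_Integration.integral_sum) (blast, simp)
  qed
  ultimately show ?thesis using centered_gaussian_rv(3) by simp
qed

lemma gaussian_distr_PiM_cong:
  fixes X :: "'k \<Rightarrow> 'a \<Rightarrow> real" and X' :: "'k \<Rightarrow> 'b \<Rightarrow> real"
  assumes "prob_space M" "prob_space M'"
    and X: "gaussian_family M K X" "\<And>k. k \<in> K \<Longrightarrow> (LINT \<omega>|M. X k \<omega>) = 0"
    and X': "gaussian_family M' K X'" "\<And>k. k \<in> K \<Longrightarrow> (LINT \<omega>|M'. X' k \<omega>) = 0"
    and cov: "\<And>k l. k \<in> K \<Longrightarrow> l \<in> K \<Longrightarrow>
      (LINT \<omega>|M. X k \<omega> * X l \<omega>) = (LINT \<omega>|M'. X' k \<omega> * X' l \<omega>)"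
  shows "distr M (PiM K (\<lambda>_. borel)) (\<lambda>\<omega>. \<lambda>k\<in>K. X k \<omega>) =
    distr M' (PiM K (\<lambda>_. borel)) (\<lambda>\<omega>. \<lambda>k\<in>K. X' k \<omega>)"
proof (rule distr_PiM_cong[OF assms(1,2)])
  show "X k \<in> borel_measurable M" "X' k \<in> borel_measurable M'" if "k \<in> K" for k
    using gaussian_family_rv[OF X(1) that] gaussian_family_rv[OF X'(1) that]
    by (auto simp: gaussian_rv_def)
  fix J c d assume J: "finite J" "J \<subseteq> K"
  have "(\<Sum>k\<in>J. \<Sum>l\<in>J. c k * c l * (LINT \<omega>|M. X k \<omega> * X l \<omega>)) =
     (\<Sum>k\<in>J. \<Sum>l\<in>J. c k * c l * (LINT \<omega>|M'. X' k \<omega> * X' l \<omega>))"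
    using cov J by (intro sum.cong) (auto simp: subset_iff)
  then show "(LINT \<omega>|M. cos ((\<Sum>k\<in>J. c k * X k \<omega>) + d)) = (LINT \<omega>|M'. cos ((\<Sum>k\<in>J. c k * X' k \<omega>) + d))"
    using prob_space.gaussian_family_expectation_cos[OF assms(1) X J]
      prob_space.gaussian_family_expectation_cos[OF assms(2) X' J] by simp
qed

section \<open>Random vectors, their coordinates and the standard normal law\<close>

lemma measurable_vec_lambda[measurable (raw)]:
  fixes f :: "'a \<Rightarrow> 'n::finite \<Rightarrow> real"
  assumes "\<And>i. (\<lambda>x. f x i) \<in> borel_measurable M"
  shows "(\<lambda>x. \<chi> i. f x i) \<in> borel_measurable M"
  using assms by (subst borel_measurable_euclidean_space) (auto simp: Basis_vec_def inner_axis)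

lemma measurable_vec_nth[measurable]: "(\<lambda>x::real^'n. x $ i) \<in> borel_measurable borel"
  by (simp add: cart_eq_inner_axis)

lemma prod_Basis_cart:
  fixes g :: "real ^ 'n \<Rightarrow> 'b::comm_monoid_mult"
  shows "(\<Prod>b\<in>Basis. g b) = (\<Prod>i\<in>UNIV. g (axis i 1))"
proof -
  have "(Basis :: (real^'n) set) = range (\<lambda>i. axis i 1)"
    by (auto simp: Basis_vec_def)
  moreover have "inj (\<lambda>i. axis i 1 :: real^'n)"
    by (auto simp: inj_on_def axis_eq_axis)
  ultimately show ?thesis using prod.reindex[of "\<lambda>i. axis i 1" UNIV g] by (simp add: o_def)
qed

lemma nn_integral_lborel_prod_cart:
  fixes f :: "'n::finite \<Rightarrow> real \<Rightarrow> ennreal"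
  assumes [measurable]: "\<And>i. f i \<in> borel_measurable borel"
  shows "(\<integral>\<^sup>+x. (\<Prod>i\<in>UNIV. f i (x $ i)) \<partial>(lborel :: (real^'n) measure)) = (\<Prod>i\<in>UNIV. \<integral>\<^sup>+x. f i x \<partial>lborel)"
proof -
  have "(\<integral>\<^sup>+x. (\<Prod>b\<in>Basis. f (axis_index b) (x \<bullet> b)) \<partial>(lborel :: (real^'n) measure)) =
     (\<Prod>b\<in>(Basis :: (real^'n) set). \<integral>\<^sup>+x. f (axis_index b) x \<partial>lborel)"
    by (rule nn_integral_lborel_prod) auto
  then show ?thesis by (simp add: prod_Basis_cart inner_axis)
qed

text \<open>Passing to coordinates loses nothing: it is undone by the measurable map
  \<open>\<lambda>x. \<chi> i. x i\<close>, so the law of a vector is an image of the law of its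
  coordinates.\<close>

lemma distr_cart_cong:
  fixes X :: "'a \<Rightarrow> real^'n" and X' :: "'b \<Rightarrow> real^'n"
  assumes [measurable]: "X \<in> borel_measurable M" "X' \<in> borel_measurable M'"
    and "distr M (PiM UNIV (\<lambda>_. borel)) (\<lambda>\<omega>. \<lambda>i\<in>UNIV. X \<omega> $ i) =
      distr M' (PiM UNIV (\<lambda>_. borel)) (\<lambda>\<omega>. \<lambda>i\<in>UNIV. X' \<omega> $ i)"
  shows "distr M borel X = distr M' borel X'"
proof -
  have "distr N borel Y = distr (distr N (PiM UNIV (\<lambda>_. borel)) (\<lambda>\<omega>. \<lambda>i\<in>UNIV. Y \<omega> $ i)) borel (\<lambda>x. \<chi> i. x i)"
    if [measurable]: "Y \<in> borel_measurable N" for N :: "'c measure" and Y :: "'c \<Rightarrow> real^'n"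
  proof -
    have "(\<lambda>\<omega>. \<lambda>i\<in>UNIV. Y \<omega> $ i) \<in> measurable N (PiM UNIV (\<lambda>_. borel))"
      by measurable
    then show ?thesis
      by (subst distr_distr) (simp_all add: comp_def restrict_def)
  qed
  from this[of X M] this[of X' M'] assms(3) show ?thesis by simp
qed

text \<open>Connects the product measure, for which characteristic functions factor, with the
  Lebesgue density that \<open>fractional_brownian_motion\<close> prescribes for \<open>X 1\<close>.
  Boxes suffice, and on a box the density integral splits into coordinates.\<close>

lemma PiM_std_normal:
  "PiM UNIV (\<lambda>_::'n::finite. std_normal_distribution) =
    distr (density lborel (\<lambda>z::real^'n. ennreal (\<Prod>i\<in>UNIV. std_normal_density (z $ i))))
      (PiM UNIV (\<lambda>_. borel)) (\<lambda>z. \<lambda>i\<in>UNIV. z $ i)" (is "?P = distr ?D _ _")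
proof (rule product_sigma_finite.PiM_eqI[symmetric])
  interpret prob_space std_normal_distribution
    by (rule prob_space_normal_density) simp
  show "product_sigma_finite (\<lambda>_::'n. std_normal_distribution)" ..
  fix A :: "'n \<Rightarrow> real set" assume A: "\<And>i. i \<in> UNIV \<Longrightarrow> A i \<in> sets std_normal_distribution"
  then have [measurable]: "A i \<in> sets borel" for i by simp
  have E[measurable]: "Pi\<^sub>E UNIV A \<in> sets (PiM UNIV (\<lambda>_. borel))"
    by (intro sets_PiM_I_finite) auto
  have ind: "indicator ((\<lambda>z. \<lambda>i\<in>UNIV. z $ i) -` Pi\<^sub>E UNIV A) z = (\<Prod>i\<in>UNIV. indicator (A i) (z $ i) :: ennreal)"
    for z :: "real^'n"
  proof (cases "\<forall>i. z $ i \<in> A i")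
    case True
    then show ?thesis by (simp add: PiE_iff)
  next
    case False
    then obtain i where "z $ i \<notin> A i" by blast
    then have "(\<Prod>i\<in>UNIV. indicator (A i) (z $ i) :: ennreal) = 0"
      by (intro prod_zero bexI[of _ i]) auto
    with False show ?thesis by (simp add: PiE_iff)
  qed
  have f: "(\<lambda>z::real^'n. \<lambda>i\<in>UNIV. z $ i) \<in> measurable borel (PiM UNIV (\<lambda>_. borel))"
    by measurable
  have "(\<lambda>z::real^'n. \<lambda>i\<in>UNIV. z $ i) -` Pi\<^sub>E UNIV A \<in> sets borel"
    using measurable_sets[OF f E] by simp
  then have "emeasure (distr ?D (PiM UNIV (\<lambda>_. borel)) (\<lambda>z. \<lambda>i\<in>UNIV. z $ i)) (Pi\<^sub>E UNIV A) =
     (\<integral>\<^sup>+z. (\<Prod>i\<in>UNIV. ennreal (std_normal_density (z $ i)) * indicator (A i) (z $ i)) \<partial>lborel)"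
    by (simp add: emeasure_distr emeasure_density prod.distrib ind prod_ennreal)
  also have "\<dots> = (\<Prod>i\<in>UNIV. \<integral>\<^sup>+x. ennreal (std_normal_density x) * indicator (A i) x \<partial>lborel)"
    by (rule nn_integral_lborel_prod_cart) simp
  finally show "emeasure (distr ?D (PiM UNIV (\<lambda>_. borel)) (\<lambda>z. \<lambda>i\<in>UNIV. z $ i)) (Pi\<^sub>E UNIV A) =
      (\<Prod>i\<in>UNIV. emeasure std_normal_distribution (A i))"
    by (simp add: emeasure_density)
next
  show "sets (distr ?D (PiM UNIV (\<lambda>_. borel)) (\<lambda>z. \<lambda>i\<in>UNIV. z $ i)) = sets ?P"
    by (simp cong: sets_PiM_cong)
qed simp

lemma PiM_std_normal_expectation_cos:
  fixes c :: "'n::finite \<Rightarrow> real"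
  shows "(LINT \<omega>|PiM UNIV (\<lambda>_::'n. std_normal_distribution). cos ((\<Sum>k\<in>J. c k * \<omega> k) + d)) =
    cos d * exp (- (\<Sum>k\<in>J. (c k)\<^sup>2) / 2)"
proof -
  interpret N: prob_space std_normal_distribution
    by (rule prob_space_normal_density) simp
  interpret P: product_prob_space "\<lambda>_::'n. std_normal_distribution" UNIV ..
  have [measurable]: "(\<lambda>\<omega>. \<omega> k) \<in> borel_measurable (PiM UNIV (\<lambda>_::'n. std_normal_distribution))" for k
    by (rule measurable_compose[OF measurable_component_singleton]) auto
  \<comment> \<open>Extension of the coefficients by 0, so that the product formula runs over all
    coordinates.\<close>
  define e where "e k = (if k \<in> J then c k else 0)" for k
  have "(\<Sum>k\<in>J. c k * \<omega> k) = (\<Sum>k\<in>UNIV. e k * \<omega> k)" for \<omega>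
    unfolding e_def by (rule sum.mono_neutral_cong_left) auto
  moreover have "(\<Sum>k\<in>J. (c k)\<^sup>2) = (\<Sum>k\<in>UNIV. (e k)\<^sup>2)"
    unfolding e_def by (rule sum.mono_neutral_cong_left) auto
  moreover have "char (distr (PiM UNIV (\<lambda>_::'n. std_normal_distribution)) borel (\<lambda>\<omega>. \<Sum>k\<in>UNIV. e k * \<omega> k)) 1 =
     exp (- (\<Sum>k\<in>UNIV. (e k)\<^sup>2) / 2)"
  proof -
    have "iexp (\<Sum>k\<in>UNIV. e k * \<omega> k) = (\<Prod>k\<in>UNIV. iexp (e k * \<omega> k))" for \<omega>
      by (simp add: exp_sum sum_distrib_left)
    then have "char (distr (PiM UNIV (\<lambda>_::'n. std_normal_distribution)) borel (\<lambda>\<omega>. \<Sum>k\<in>UNIV. e k * \<omega> k)) 1 =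
       (CLINT \<omega>|PiM UNIV (\<lambda>_::'n. std_normal_distribution). \<Prod>k\<in>UNIV. iexp (e k * \<omega> k))"
      by (simp add: char_def integral_distr)
    also have "\<dots> = (\<Prod>k\<in>UNIV. char std_normal_distribution (e k))"
      unfolding char_def
      by (rule P.product_integral_prod) (auto intro!: N.integrable_const_bound[of _ 1])
    finally show ?thesis
      by (simp only: char_std_normal_distribution exp_sum[symmetric] finite_class.finite_UNIV
        of_real_prod[symmetric] sum_divide_distrib[symmetric] sum_negf)
  qed
  moreover have "(LINT \<omega>|PiM UNIV (\<lambda>_::'n. std_normal_distribution). cos ((\<Sum>k\<in>UNIV. e k * \<omega> k) + d)) =
      Re (iexp d * char (distr (PiM UNIV (\<lambda>_::'n. std_normal_distribution)) borel (\<lambda>\<omega>. \<Sum>k\<in>UNIV. e k * \<omega> k)) 1)"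
    by (rule P.P.expectation_cos_char) measurable
  ultimately show ?thesis
    by (simp add: Re_exp)
qed

text \<open>With identity covariance the quadratic form of a Gaussian family is the sum of squares
  that the product of standard normal measures produces, so the cosine expectations
  coincide.\<close>

lemma distributed_std_normal_vec:
  fixes X :: "'a \<Rightarrow> real^'n"
  assumes M: "prob_space M" and [measurable]: "X \<in> borel_measurable M"
    and X: "gaussian_family M UNIV (\<lambda>i \<omega>. X \<omega> $ i)" "\<And>i. (LINT \<omega>|M. X \<omega> $ i) = 0"
    and cov: "\<And>i j. (LINT \<omega>|M. X \<omega> $ i * X \<omega> $ j) = (if i = j then 1 else 0)"
  shows "distributed M lborel X (\<lambda>z. ennreal (\<Prod>i\<in>UNIV. std_normal_density (z $ i)))" (is "distributed M _ _ ?g")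
proof -
  interpret M: prob_space M by fact
  let ?P = "PiM UNIV (\<lambda>_::'n. std_normal_distribution)"
  interpret P: prob_space ?P
    by (intro prob_space_PiM prob_space_normal_density) simp
  have "distr M (PiM UNIV (\<lambda>_. borel)) (\<lambda>\<omega>. \<lambda>i\<in>UNIV. X \<omega> $ i) =
     distr ?P (PiM UNIV (\<lambda>_. borel)) (\<lambda>\<omega>. \<lambda>i\<in>UNIV. \<omega> i)"
  proof (rule distr_PiM_cong[OF M P.prob_space_axioms])
    fix J :: "'n set" and c :: "'n \<Rightarrow> real" and d :: real
    have "c k * c l * (if k = l then 1 else 0) = (if k = l then (c k)\<^sup>2 else 0)" for k l
      by (simp add: power2_eq_square)
    then have "(\<Sum>k\<in>J. \<Sum>l\<in>J. c k * c l * (LINT \<omega>|M. X \<omega> $ k * X \<omega> $ l)) = (\<Sum>k\<in>J. (c k)\<^sup>2)"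
      by (simp add: cov)
    then show "(LINT \<omega>|M. cos ((\<Sum>k\<in>J. c k * X \<omega> $ k) + d)) = (LINT \<omega>|?P. cos ((\<Sum>k\<in>J. c k * \<omega> k) + d))"
      using M.gaussian_family_expectation_cos[OF X, of J c d]
      by (simp add: PiM_std_normal_expectation_cos)
  next
    show "(\<lambda>\<omega>. \<omega> k) \<in> borel_measurable ?P" for k
      by (rule measurable_compose[OF measurable_component_singleton]) auto
  qed simp
  also have "\<dots> = distr ?P (PiM UNIV (\<lambda>_. borel)) (\<lambda>\<omega>. \<omega>)" by (simp add: restrict_def)
  also have "\<dots> = ?P" by (rule distr_id2) (simp cong: sets_PiM_cong)
  also have "\<dots> = distr (density lborel ?g) (PiM UNIV (\<lambda>_. borel)) (\<lambda>z. \<lambda>i\<in>UNIV. z $ i)"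
    by (rule PiM_std_normal)
  finally have "distr M borel X = distr (density lborel ?g) borel (\<lambda>z. z)"
    by (intro distr_cart_cong) simp_all
  also have "\<dots> = density lborel ?g" by (rule distr_id2) simp
  also have "distr M borel X = distr M lborel X" by (rule distr_cong) auto
  finally show ?thesis by (simp add: distributed_def)
qed

section \<open>Fractional Brownian motion from its covariance\<close>

text \<open>A linear combination of linear combinations is one of the original variables. This
  covers increments, scaling, time changes and the passage from the noise to the process.\<close>

lemma gaussian_family_lincomb:
  assumes X: "gaussian_family M K X"
    and A: "\<And>l. l \<in> L \<Longrightarrow> finite (A l)" "\<And>l. l \<in> L \<Longrightarrow> A l \<subseteq> K"
    and Y: "\<And>l \<omega>. l \<in> L \<Longrightarrow> Y l \<omega> = (\<Sum>k\<in>A l. a l k * X k \<omega>)"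
  shows "gaussian_family M L Y"
  unfolding gaussian_family_def
proof (intro allI impI, elim conjE)
  fix J c assume J: "finite J" "J \<subseteq> L"
  let ?U = "\<Union>l\<in>J. A l"
  \<comment> \<open>The sets \<open>A l\<close> may overlap, so the coefficient of
    \<open>X k\<close> is collected from all \<open>l\<close> with
    \<open>k \<in> A l\<close>.\<close>
  let ?b = "\<lambda>k. \<Sum>l\<in>J. if k \<in> A l then c l * a l k else 0"
  have U: "finite ?U" "?U \<subseteq> K" using J A by auto
  have "(\<Sum>l\<in>J. c l * Y l \<omega>) = (\<Sum>k\<in>?U. ?b k * X k \<omega>)" for \<omega>
  proof -
    have "c l * Y l \<omega> = (\<Sum>k\<in>?U. if k \<in> A l then c l * a l k * X k \<omega> else 0)" if "l \<in> J" for l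
    proof -
      have "c l * Y l \<omega> = (\<Sum>k\<in>A l. c l * a l k * X k \<omega>)"
        using that J Y by (auto simp: sum_distrib_left mult.assoc)
      also have "\<dots> = (\<Sum>k\<in>?U. if k \<in> A l then c l * a l k * X k \<omega> else 0)"
        using that U(1) by (intro sum.mono_neutral_cong_left) auto
      finally show ?thesis .
    qed
    then have "(\<Sum>l\<in>J. c l * Y l \<omega>) = (\<Sum>l\<in>J. \<Sum>k\<in>?U. if k \<in> A l then c l * a l k * X k \<omega> else 0)"
      by (intro sum.cong) auto
    also have "\<dots> = (\<Sum>k\<in>?U. \<Sum>l\<in>J. if k \<in> A l then c l * a l k * X k \<omega> else 0)"
      by (rule sum.swap)
    also have "\<dots> = (\<Sum>k\<in>?U. ?b k * X k \<omega>)"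
      by (intro sum.cong refl) (auto simp: sum_distrib_right intro!: sum.cong)
    finally show ?thesis .
  qed
  moreover have "gaussian_rv M (\<lambda>\<omega>. \<Sum>k\<in>?U. ?b k * X k \<omega>)"
    using X U unfolding gaussian_family_def by (elim allE[of _ ?U] allE[of _ ?b]) blast
  ultimately show "gaussian_rv M (\<lambda>\<omega>. \<Sum>l\<in>J. c l * Y l \<omega>)" by simp
qed

lemma measurable_restrict_vec_lambda:
  "(\<lambda>x. \<lambda>t\<in>T. \<chi> i. x (t, i)) \<in> measurable (PiM (T \<times> (UNIV :: 'n::finite set)) (\<lambda>_. borel :: real measure))
     (PiM T (\<lambda>_. borel :: (real^'n) measure))"
  by (intro measurable_restrict measurable_vec_lambda measurable_component_singleton) auto

text \<open>A vector-valued process is read off measurably from the real family indexed by time and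
  component, which brings laws of processes within reach of the results for real families.\<close>

lemma distr_PiM_cart_cong:
  fixes X :: "'t \<Rightarrow> 'a \<Rightarrow> real^'n" and X' :: "'t \<Rightarrow> 'b \<Rightarrow> real^'n"
  assumes [measurable]: "\<And>t. t \<in> T \<Longrightarrow> X t \<in> borel_measurable M" "\<And>t. t \<in> T \<Longrightarrow> X' t \<in> borel_measurable M'"
    and eq: "distr M (PiM (T \<times> UNIV) (\<lambda>_. borel)) (\<lambda>\<omega>. \<lambda>k\<in>T \<times> UNIV. X (fst k) \<omega> $ snd k) =
      distr M' (PiM (T \<times> UNIV) (\<lambda>_. borel)) (\<lambda>\<omega>. \<lambda>k\<in>T \<times> UNIV. X' (fst k) \<omega> $ snd k)"
  shows "distr M (PiM T (\<lambda>_. borel)) (\<lambda>\<omega>. \<lambda>t\<in>T. X t \<omega>) = distr M' (PiM T (\<lambda>_. borel)) (\<lambda>\<omega>. \<lambda>t\<in>T. X' t \<omega>)"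
proof -
  have "distr N (PiM T (\<lambda>_. borel)) (\<lambda>\<omega>. \<lambda>t\<in>T. Y t \<omega>) =
     distr (distr N (PiM (T \<times> UNIV) (\<lambda>_. borel)) (\<lambda>\<omega>. \<lambda>k\<in>T \<times> UNIV. Y (fst k) \<omega> $ snd k))
       (PiM T (\<lambda>_. borel)) (\<lambda>x. \<lambda>t\<in>T. \<chi> i. x (t, i))"
    if Y: "\<And>t. t \<in> T \<Longrightarrow> Y t \<in> borel_measurable N" for N :: "'c measure" and Y :: "'t \<Rightarrow> 'c \<Rightarrow> real^'n"
  proof -
    have "(\<lambda>\<omega>. \<lambda>k\<in>T \<times> UNIV. Y (fst k) \<omega> $ snd k) \<in> measurable N (PiM (T \<times> UNIV) (\<lambda>_. borel))"
      using measurable_compose[OF Y measurable_vec_nth] by (intro measurable_restrict) auto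
    then show ?thesis
      by (subst distr_distr[OF measurable_restrict_vec_lambda])
        (auto simp: comp_def intro!: distr_cong)
  qed
  from this[of X M] this[of X' M'] show ?thesis using assms by simp
qed

text \<open>Each clause about laws is a statement about covariances: increments over a time
  \<open>h\<close> have covariance \<open>h powr (2 * H)\<close> times the identity, the covariance
  is homogeneous of degree \<open>2 * H\<close>, and at time 1 it is the identity.\<close>

lemma fractional_brownian_motionI:
  fixes X :: "real \<Rightarrow> 'a \<Rightarrow> real^'n"
  assumes M: "prob_space M" and H: "0 < H" "H \<le> 1"
    and meas: "\<And>t. t \<ge> 0 \<Longrightarrow> X t \<in> borel_measurable M"
    and X0: "AE \<omega> in M. X 0 \<omega> = 0"
    and G: "gaussian_family M ({0..} \<times> UNIV) (\<lambda>(t, i) \<omega>. X t \<omega> $ i)"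
    and mean: "\<And>t i. t \<ge> 0 \<Longrightarrow> (LINT \<omega>|M. X t \<omega> $ i) = 0"
    and cov: "\<And>s t i j. s \<ge> 0 \<Longrightarrow> t \<ge> 0 \<Longrightarrow> (LINT \<omega>|M. X s \<omega> $ i * X t \<omega> $ j) =
        (if i = j then (s powr (2 * H) + t powr (2 * H) - \<bar>t - s\<bar> powr (2 * H)) / 2 else 0)"
  shows "fractional_brownian_motion M H X"
proof -
  interpret prob_space M by fact
  have mean': "expectation ((\<lambda>(t, i) \<omega>. X t \<omega> $ i) k) = 0" if "k \<in> {0..} \<times> UNIV" for k
    using that mean by auto
  note int0 = gaussian_family_integrable[OF G mean']
  have int1: "integrable M (\<lambda>\<omega>. X t \<omega> $ i)" if "t \<ge> 0" for t i
    using int0(1)[of "(t, i)"] that by simp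
  have int2: "integrable M (\<lambda>\<omega>. X s \<omega> $ i * X t \<omega> $ j)" if "s \<ge> 0" "t \<ge> 0" for s t i j
    using int0(2)[of "(s, i)" "(t, j)"] that by simp
  note lin = gaussian_family_lincomb[OF G]
  have incr: "distr M borel (\<lambda>\<omega>. X (t + h) \<omega> - X t \<omega>) = distr M borel (\<lambda>\<omega>. X (t' + h) \<omega> - X t' \<omega>)"
    if "h > 0" "t > 0" "t' > 0" for h t t'
  proof (rule distr_cart_cong)
    show "(\<lambda>\<omega>. X (t + h) \<omega> - X t \<omega>) \<in> borel_measurable M" "(\<lambda>\<omega>. X (t' + h) \<omega> - X t' \<omega>) \<in> borel_measurable M"
      using that meas by simp_all
    show "distr M (PiM UNIV (\<lambda>_. borel)) (\<lambda>\<omega>. \<lambda>i\<in>UNIV. (X (t + h) \<omega> - X t \<omega>) $ i) =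
      distr M (PiM UNIV (\<lambda>_. borel)) (\<lambda>\<omega>. \<lambda>i\<in>UNIV. (X (t' + h) \<omega> - X t' \<omega>) $ i)"
    proof (rule gaussian_distr_PiM_cong[OF M M])
      \<comment> \<open>As \<open>h > 0\<close>, the two indices \<open>(s + h, i)\<close> and
        \<open>(s, i)\<close> differ, and \<open>fst k = s\<close> tells which of them carries the
        coefficient -1.\<close>
      have g: "gaussian_family M UNIV (\<lambda>i \<omega>. (X (s + h) \<omega> - X s \<omega>) $ i)" if "s > 0" for s
        using that \<open>h > 0\<close>
        by (intro lin[where A = "\<lambda>i. {(s + h, i), (s, i)}" and a = "\<lambda>i k. if fst k = s then - 1 else 1"]) auto
      show "gaussian_family M UNIV (\<lambda>i \<omega>. (X (t + h) \<omega> - X t \<omega>) $ i)"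
        "gaussian_family M UNIV (\<lambda>i \<omega>. (X (t' + h) \<omega> - X t' \<omega>) $ i)"
        using g that by auto
      show "expectation (\<lambda>\<omega>. (X (t + h) \<omega> - X t \<omega>) $ i) = 0"
        "expectation (\<lambda>\<omega>. (X (t' + h) \<omega> - X t' \<omega>) $ i) = 0" for i
        using that int1 mean by simp_all
      have "expectation (\<lambda>\<omega>. (X (s + h) \<omega> - X s \<omega>) $ i * (X (s + h) \<omega> - X s \<omega>) $ j) =
          (if i = j then h powr (2 * H) else 0)" if "s > 0" for s i j
      proof -
        have "expectation (\<lambda>\<omega>. (X (s + h) \<omega> - X s \<omega>) $ i * (X (s + h) \<omega> - X s \<omega>) $ j) =
          expectation (\<lambda>\<omega>. (X (s + h) \<omega> $ i * X (s + h) \<omega> $ j - X (s + h) \<omega> $ i * X s \<omega> $ j) -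
             (X s \<omega> $ i * X (s + h) \<omega> $ j - X s \<omega> $ i * X s \<omega> $ j))"
          by (intro Bochner_Integration.integral_cong) (auto simp: algebra_simps)
        also have "\<dots> = (if i = j then h powr (2 * H) else 0)"
          using that \<open>h > 0\<close> H int2
          by (subst Bochner_Integration.integral_diff, simp, simp,
            subst Bochner_Integration.integral_diff, simp, simp,
            subst Bochner_Integration.integral_diff, simp, simp) (simp add: cov field_simps)
        finally show ?thesis .
      qed
      then show "expectation (\<lambda>\<omega>. (X (t + h) \<omega> - X t \<omega>) $ i * (X (t + h) \<omega> - X t \<omega>) $ j) =
         expectation (\<lambda>\<omega>. (X (t' + h) \<omega> - X t' \<omega>) $ i * (X (t' + h) \<omega> - X t' \<omega>) $ j)" for i j
        using that by simp
    qed
  qed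
  have sim: "distr M (PiM {0..} (\<lambda>_. borel)) (\<lambda>\<omega>. \<lambda>t\<in>{0..}. X (c * t) \<omega>) =
     distr M (PiM {0..} (\<lambda>_. borel)) (\<lambda>\<omega>. \<lambda>t\<in>{0..}. (c powr H) *\<^sub>R X t \<omega>)" if "c > 0" for c
  proof (rule distr_PiM_cart_cong)
    show "X (c * t) \<in> borel_measurable M" "(\<lambda>\<omega>. (c powr H) *\<^sub>R X t \<omega>) \<in> borel_measurable M"
      if "t \<in> {0..}" for t
      using that \<open>c > 0\<close> meas by auto
    show "distr M (PiM ({0..} \<times> UNIV) (\<lambda>_. borel)) (\<lambda>\<omega>. \<lambda>k\<in>{0..} \<times> UNIV. X (c * fst k) \<omega> $ snd k) =
      distr M (PiM ({0..} \<times> UNIV) (\<lambda>_. borel)) (\<lambda>\<omega>. \<lambda>k\<in>{0..} \<times> UNIV. ((c powr H) *\<^sub>R X (fst k) \<omega>) $ snd k)"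
    proof (rule gaussian_distr_PiM_cong[OF M M])
      show "gaussian_family M ({0..} \<times> UNIV) (\<lambda>k \<omega>. X (c * fst k) \<omega> $ snd k)"
        using \<open>c > 0\<close> by (intro lin[where A = "\<lambda>k. {(c * fst k, snd k)}" and a = "\<lambda>_ _. 1"]) auto
      show "gaussian_family M ({0..} \<times> UNIV) (\<lambda>k \<omega>. ((c powr H) *\<^sub>R X (fst k) \<omega>) $ snd k)"
        by (intro lin[where A = "\<lambda>k. {k}" and a = "\<lambda>_ _. c powr H"]) auto
      fix k l :: "real \<times> 'n" assume k: "k \<in> {0..} \<times> UNIV" and l: "l \<in> {0..} \<times> UNIV"
      then have kl: "0 \<le> fst k" "0 \<le> fst l" "0 \<le> c * fst k" "0 \<le> c * fst l" using \<open>c > 0\<close> by auto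
      show "expectation (\<lambda>\<omega>. X (c * fst k) \<omega> $ snd k) = 0"
        "expectation (\<lambda>\<omega>. ((c powr H) *\<^sub>R X (fst k) \<omega>) $ snd k) = 0"
        using kl mean by auto
      have "\<bar>c * fst l - c * fst k\<bar> = c * \<bar>fst l - fst k\<bar>"
        using \<open>c > 0\<close> by (simp add: abs_mult flip: right_diff_distrib)
      moreover have "c powr (2 * H) = c powr H * c powr H"
        by (simp add: powr_add[symmetric])
      ultimately have "expectation (\<lambda>\<omega>. X (c * fst k) \<omega> $ snd k * X (c * fst l) \<omega> $ snd l) =
          c powr H * c powr H * expectation (\<lambda>\<omega>. X (fst k) \<omega> $ snd k * X (fst l) \<omega> $ snd l)"
        using \<open>c > 0\<close> kl by (simp add: cov powr_mult algebra_simps)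
      also have "\<dots> = expectation (\<lambda>\<omega>. c powr H * c powr H * (X (fst k) \<omega> $ snd k * X (fst l) \<omega> $ snd l))"
        by simp
      finally show "expectation (\<lambda>\<omega>. X (c * fst k) \<omega> $ snd k * X (c * fst l) \<omega> $ snd l) =
        expectation (\<lambda>\<omega>. ((c powr H) *\<^sub>R X (fst k) \<omega>) $ snd k * ((c powr H) *\<^sub>R X (fst l) \<omega>) $ snd l)"
        by (simp add: mult_ac)
    qed
  qed
  have "distributed M lborel (X 1) (\<lambda>z. ennreal (\<Prod>i\<in>UNIV. std_normal_density (z $ i)))"
  proof (rule distributed_std_normal_vec[OF M])
    show "gaussian_family M UNIV (\<lambda>i \<omega>. X 1 \<omega> $ i)"
      by (intro lin[where A = "\<lambda>i. {(1, i)}" and a = "\<lambda>_ _. 1"]) auto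
  qed (use meas mean cov in auto)
  with assms incr sim show ?thesis
    unfolding fractional_brownian_motion_def by blast
qed

lemma fractional_brownian_motion_noise:
  fixes F :: "(real \<Rightarrow> real ^ 'N \<Rightarrow> real) \<Rightarrow> 'w \<Rightarrow> real ^ 'n"
  assumes M: "prob_space M" and F: "gaussian_noise M \<alpha> F" and H: "0 < H" "H \<le> 1"
    and f: "\<And>t. t \<ge> 0 \<Longrightarrow> f t \<in> noise_dom \<alpha>" and f0: "f 0 = (\<lambda>_ _. 0)"
    and cov: "\<And>s t. s \<ge> 0 \<Longrightarrow> t \<ge> 0 \<Longrightarrow>
      K\<^sup>2 * noise_cov \<alpha> (f s) (f t) = (s powr (2 * H) + t powr (2 * H) - \<bar>t - s\<bar> powr (2 * H)) / 2"
  shows "fractional_brownian_motion M H (\<lambda>t \<omega>. K *\<^sub>R F (f t) \<omega>)"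
proof (rule fractional_brownian_motionI[OF M H])
  show "(\<lambda>\<omega>. K *\<^sub>R F (f t) \<omega>) \<in> borel_measurable M" if "t \<ge> 0" for t
  proof -
    have "F (f t) \<in> borel_measurable M"
      using F f[OF that] unfolding gaussian_noise_def by blast
    then show ?thesis by simp
  qed
  show "AE \<omega> in M. K *\<^sub>R F (f 0) \<omega> = 0"
  proof -
    \<comment> \<open>Linearity with both coefficients 0: it shows that \<open>F\<close> maps the
      zero function to 0 almost surely.\<close>
    have "AE \<omega> in M. F (\<lambda>t x. 0 * f 0 t x + 0 * f 0 t x) \<omega> = 0 *\<^sub>R F (f 0) \<omega> + 0 *\<^sub>R F (f 0) \<omega>"
      using F f[of 0] unfolding gaussian_noise_def by blast
    then show ?thesis by (simp add: f0)
  qed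
  have G: "gaussian_family M (noise_dom \<alpha> \<times> UNIV) (\<lambda>(f, i) \<omega>. F f \<omega> $ i)"
    using F by (simp add: gaussian_noise_def)
  show "gaussian_family M ({0..} \<times> UNIV) (\<lambda>(t, i) \<omega>. (K *\<^sub>R F (f t) \<omega>) $ i)"
    by (rule gaussian_family_lincomb[OF G, where A = "\<lambda>(t, i). {(f t, i)}" and a = "\<lambda>_ _. K"]) (auto intro: f)
  fix s t :: real and i j assume t: "t \<ge> 0"
  show "(LINT \<omega>|M. (K *\<^sub>R F (f t) \<omega>) $ i) = 0"
    using F f[OF t] by (simp add: gaussian_noise_def)
  assume s: "s \<ge> 0"
  have "(LINT \<omega>|M. (K *\<^sub>R F (f s) \<omega>) $ i * (K *\<^sub>R F (f t) \<omega>) $ j) =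
      (LINT \<omega>|M. K\<^sup>2 * (F (f s) \<omega> $ i * F (f t) \<omega> $ j))"
    by (simp add: power2_eq_square mult_ac)
  also have "\<dots> = K\<^sup>2 * (if i = j then noise_cov \<alpha> (f s) (f t) else 0)"
    using F f[OF s] f[OF t] by (simp add: gaussian_noise_def)
  finally show "(LINT \<omega>|M. (K *\<^sub>R F (f s) \<omega>) $ i * (K *\<^sub>R F (f t) \<omega>) $ j) =
      (if i = j then (s powr (2 * H) + t powr (2 * H) - \<bar>t - s\<bar> powr (2 * H)) / 2 else 0)"
    using cov[OF s t] by simp
qed

section \<open>The heat kernel paired with the Riesz kernel\<close>

lemma heat_kernel_nonneg: "0 \<le> heat_kernel t x"
  by (simp add: heat_kernel_def)

lemma measurable_heat_kernel:
  "(\<lambda>p :: real \<times> (real^'N). heat_kernel (fst p) (snd p)) \<in> borel_measurable (borel \<Otimes>\<^sub>M borel)"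
  unfolding heat_kernel_def by measurable

lemma borel_measurable_heat_kernel[measurable (raw)]:
  fixes g :: "'a \<Rightarrow> real^'N"
  assumes [measurable]: "f \<in> borel_measurable M" "g \<in> borel_measurable M"
  shows "(\<lambda>x. heat_kernel (f x) (g x)) \<in> borel_measurable M"
  using measurable_compose[OF measurable_Pair[OF assms] measurable_heat_kernel] by simp

lemma inverse_sqrt_power:
  assumes "p > 0"
  shows "(1 / sqrt p) ^ n = p powr (- (real n / 2))"
proof -
  have "1 / sqrt p = p powr (- (1 / 2))"
    using assms by (simp only: powr_minus powr_half_sqrt[OF less_imp_le] inverse_eq_divide)
  then have "(1 / sqrt p) ^ n = (p powr (- (1 / 2))) powr real n"
    using powr_realpow[of "p powr (- (1 / 2))" n] assms by simp
  then show ?thesis by (simp add: powr_powr)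
qed

lemma exp_norm_square_cart:
  "exp (- c * (norm (z :: real^'n))\<^sup>2) = (\<Prod>i\<in>UNIV. exp (- c * (z $ i)\<^sup>2))"
proof -
  have "(norm z)\<^sup>2 = (\<Sum>i\<in>UNIV. (z $ i)\<^sup>2)"
    by (simp add: norm_vec_def L2_set_def sum_nonneg)
  then have "- c * (norm z)\<^sup>2 = (\<Sum>i\<in>UNIV. - c * (z $ i)\<^sup>2)"
    by (simp only: sum_distrib_left)
  then show ?thesis by (simp only: exp_sum finite_class.finite_UNIV)
qed

text \<open>The heat kernel at time \<open>t\<close> is the density of independent normal
  coordinates of variance \<open>2 * t\<close>, which reduces Gaussian integrals to dimension
  one.\<close>

lemma heat_kernel_prod:
  fixes x :: "real^'N"
  assumes "t > 0"
  shows "heat_kernel t x = (\<Prod>i\<in>UNIV. normal_density 0 (sqrt (2 * t)) (x $ i))"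
proof -
  have "normal_density 0 (sqrt (2 * t)) u = 1 / sqrt (4 * pi * t) * exp (- (1 / (4 * t)) * u\<^sup>2)" for u
    using assms by (simp add: normal_density_def mult_ac)
  then have "(\<Prod>i\<in>UNIV. normal_density 0 (sqrt (2 * t)) (x $ i)) =
      (1 / sqrt (4 * pi * t)) ^ CARD('N) * exp (- (1 / (4 * t)) * (norm x)\<^sup>2)"
    by (simp only: exp_norm_square_cart prod.distrib prod_constant)
  also have "(1 / sqrt (4 * pi * t)) ^ CARD('N) = (4 * pi * t) powr (- (real CARD('N) / 2))"
    using assms by (intro inverse_sqrt_power) simp
  finally show ?thesis using assms by (simp add: heat_kernel_def)
qed

text \<open>Up to the factor \<open>sqrt (l / pi)\<close>, which is cancelled at the end, the
  exponential is a normal density of variance \<open>1 / (2 * l)\<close>. The integral is thus a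
  convolution of normal densities, and the variances add up to
  \<open>(1 + 4 * b * l) / (2 * l)\<close>.\<close>

lemma nn_integral_normal_gauss:
  assumes b: "b > 0" and l: "l > 0"
  shows "(\<integral>\<^sup>+y. ennreal (normal_density 0 (sqrt (2 * b)) y * exp (- l * (x - y)\<^sup>2)) \<partial>lborel) =
    ennreal (1 / sqrt (1 + 4 * b * l) * exp (- l * x\<^sup>2 / (1 + 4 * b * l)))"
proof -
  let ?s = "sqrt (1 / (2 * l))" and ?t = "sqrt (2 * b)"
  have c: "(\<integral>\<^sup>+y. ennreal (normal_density 0 ?s (x - y) * normal_density 0 ?t y) \<partial>lborel) =
     normal_density 0 (sqrt (?s\<^sup>2 + ?t\<^sup>2)) x"
    using conv_normal_density_zero_mean[of ?s ?t] b l by (simp add: fun_eq_iff)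
  have s: "normal_density 0 ?s u = sqrt (l / pi) * exp (- l * u\<^sup>2)" for u
    using l by (simp add: normal_density_def real_sqrt_divide divide_simps)
  have v: "?s\<^sup>2 + ?t\<^sup>2 = (1 + 4 * b * l) / (2 * l)"
    using b l by (simp add: field_simps)
  have p: "0 < 1 + 4 * b * l" using b l by (simp add: add_pos_nonneg)
  have "normal_density 0 (sqrt ((1 + 4 * b * l) / (2 * l))) x =
      sqrt (l / pi) * (1 / sqrt (1 + 4 * b * l) * exp (- l * x\<^sup>2 / (1 + 4 * b * l)))"
  proof -
    have "1 / sqrt (2 * pi * ((1 + 4 * b * l) / (2 * l))) = sqrt (l / pi) * (1 / sqrt (1 + 4 * b * l))"
      using l p by (simp add: real_sqrt_divide real_sqrt_mult)
    moreover have "- (x - 0)\<^sup>2 / (2 * (P / (2 * l))) = - l * x\<^sup>2 / P" for P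
      using l by simp
    moreover have "(sqrt ((1 + 4 * b * l) / (2 * l)))\<^sup>2 = (1 + 4 * b * l) / (2 * l)"
      using l p by simp
    ultimately show ?thesis unfolding normal_density_def by (simp only: mult.assoc)
  qed
  note nd = this
  have "ennreal (sqrt (l / pi)) * (\<integral>\<^sup>+y. ennreal (normal_density 0 ?t y * exp (- l * (x - y)\<^sup>2)) \<partial>lborel) =
      (\<integral>\<^sup>+y. ennreal (normal_density 0 ?s (x - y) * normal_density 0 ?t y) \<partial>lborel)"
    using l by (subst nn_integral_cmult[symmetric])
      (simp_all only: s, simp_all add: mult_ac flip: ennreal_mult')
  also have "\<dots> = ennreal (sqrt (l / pi)) * ennreal (1 / sqrt (1 + 4 * b * l) * exp (- l * x\<^sup>2 / (1 + 4 * b * l)))"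
    unfolding c v nd using l by (intro ennreal_mult') simp
  finally have "ennreal (sqrt (l / pi)) * (\<integral>\<^sup>+y. ennreal (normal_density 0 ?t y * exp (- l * (x - y)\<^sup>2)) \<partial>lborel) =
      ennreal (sqrt (l / pi)) * ennreal (1 / sqrt (1 + 4 * b * l) * exp (- l * x\<^sup>2 / (1 + 4 * b * l)))" .
  then show ?thesis
    using l by (subst (asm) ennreal_mult_cancel_left) auto
qed

lemma nn_integral_heat_kernel_gauss:
  fixes x :: "real^'N"
  assumes b: "b > 0" and l: "l > 0"
  shows "(\<integral>\<^sup>+y. ennreal (heat_kernel b y * exp (- l * (norm (x - y))\<^sup>2)) \<partial>lborel) =
    ennreal ((1 + 4 * b * l) powr (- (real CARD('N) / 2)) * exp (- (l / (1 + 4 * b * l)) * (norm x)\<^sup>2))"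
proof -
  have p: "0 < 1 + 4 * b * l" using b l by (simp add: add_pos_nonneg)
  have "(\<integral>\<^sup>+y. ennreal (heat_kernel b y * exp (- l * (norm (x - y))\<^sup>2)) \<partial>lborel) =
     (\<integral>\<^sup>+y. (\<Prod>i\<in>UNIV. ennreal (normal_density 0 (sqrt (2 * b)) (y $ i) * exp (- l * (x $ i - y $ i)\<^sup>2))) \<partial>lborel)"
    using b by (simp only: heat_kernel_prod exp_norm_square_cart) (simp add: prod_ennreal prod.distrib)
  also have "\<dots> = (\<Prod>i\<in>UNIV. \<integral>\<^sup>+y. ennreal (normal_density 0 (sqrt (2 * b)) y * exp (- l * (x $ i - y)\<^sup>2)) \<partial>lborel)"
    by (rule nn_integral_lborel_prod_cart) simp
  also have "\<dots> = (\<Prod>i\<in>UNIV. ennreal (1 / sqrt (1 + 4 * b * l) * exp (- (l / (1 + 4 * b * l)) * (x $ i)\<^sup>2)))"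
    by (simp only: nn_integral_normal_gauss[OF b l]) simp
  also have "\<dots> = ennreal ((1 / sqrt (1 + 4 * b * l)) ^ CARD('N) * exp (- (l / (1 + 4 * b * l)) * (norm x)\<^sup>2))"
    using p by (subst prod_ennreal) (simp_all only: exp_norm_square_cart prod.distrib prod_constant, simp_all)
  also have "(1 / sqrt (1 + 4 * b * l)) ^ CARD('N) = (1 + 4 * b * l) powr (- (real CARD('N) / 2))"
    using p by (rule inverse_sqrt_power)
  finally show ?thesis .
qed

text \<open>Only \<open>a + b\<close> can enter: under the two heat kernels \<open>x - y\<close> is
  a Gaussian vector whose coordinates have variance \<open>2 * (a + b)\<close>. In the computation
  the integral over \<open>y\<close> leaves a Gaussian factor in \<open>x\<close> with the smaller
  parameter \<open>l'\<close>, to which the same formula applies again.\<close>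

lemma nn_integral_heat_kernel_heat_kernel_gauss:
  fixes a b l :: real
  assumes a: "a > 0" and b: "b > 0" and l: "l > 0"
  shows "(\<integral>\<^sup>+x. \<integral>\<^sup>+y. ennreal (heat_kernel a x * heat_kernel b y * exp (- l * (norm (x - y :: real^'N))\<^sup>2)) \<partial>lborel \<partial>lborel) =
    ennreal ((1 + 4 * (a + b) * l) powr (- (real CARD('N) / 2)))"
proof -
  define l' where "l' = l / (1 + 4 * b * l)"
  have p: "0 < 1 + 4 * b * l" using b l by (simp add: add_pos_nonneg)
  have l': "l' > 0" using l p by (simp add: l'_def)
  let ?c = "(1 + 4 * b * l) powr (- (real CARD('N) / 2))"
  have "(\<integral>\<^sup>+y. ennreal (heat_kernel a x * heat_kernel b y * exp (- l * (norm (x - y))\<^sup>2)) \<partial>lborel) =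
      ennreal ?c * ennreal (heat_kernel a x * exp (- l' * (norm (0 - x))\<^sup>2))" for x :: "real^'N"
  proof -
    have "(\<integral>\<^sup>+y. ennreal (heat_kernel a x * heat_kernel b y * exp (- l * (norm (x - y))\<^sup>2)) \<partial>lborel) =
      ennreal (heat_kernel a x) * (\<integral>\<^sup>+y. ennreal (heat_kernel b y * exp (- l * (norm (x - y))\<^sup>2)) \<partial>lborel)"
      by (subst nn_integral_cmult[symmetric]) (auto simp: ennreal_mult'[symmetric] heat_kernel_nonneg mult.assoc)
    also have "\<dots> = ennreal ?c * ennreal (heat_kernel a x * exp (- l' * (norm (0 - x))\<^sup>2))"
      unfolding nn_integral_heat_kernel_gauss[OF b l]
      by (simp add: l'_def heat_kernel_nonneg mult_ac flip: ennreal_mult')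
    finally show ?thesis .
  qed
  then have "(\<integral>\<^sup>+x. \<integral>\<^sup>+y. ennreal (heat_kernel a x * heat_kernel b y * exp (- l * (norm (x - y :: real^'N))\<^sup>2)) \<partial>lborel \<partial>lborel) =
     ennreal ?c * (\<integral>\<^sup>+x. ennreal (heat_kernel a x * exp (- l' * (norm (0 - x :: real^'N))\<^sup>2)) \<partial>lborel)"
    by (simp add: nn_integral_cmult)
  also have "\<dots> = ennreal ?c * ennreal ((1 + 4 * a * l') powr (- (real CARD('N) / 2)))"
    unfolding nn_integral_heat_kernel_gauss[OF a l'] by simp
  also have "\<dots> = ennreal (((1 + 4 * b * l) * (1 + 4 * a * l')) powr (- (real CARD('N) / 2)))"
    using p l' a by (simp add: powr_mult flip: ennreal_mult')
  also have "(1 + 4 * b * l) * (1 + 4 * a * l') = 1 + 4 * (a + b) * l"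
    using p by (simp add: l'_def field_simps)
  finally show ?thesis .
qed

lemma nn_integral_Gamma_scaled:
  fixes s k :: real
  assumes s: "s > 0" and k: "k > 0"
  shows "(\<integral>\<^sup>+t. ennreal (indicator {0<..} t * t powr (s - 1) * exp (- k * t)) \<partial>lborel) =
    ennreal (Gamma s * k powr (- s))"
proof -
  have "ennreal (Gamma s) = (\<integral>\<^sup>+t. ennreal (indicator {0<..} t * t powr (s - 1) * exp (- t)) \<partial>lborel)"
    unfolding Gamma_conv_nn_integral_real[OF s]
    by (intro nn_integral_cong) (auto simp: indicator_def exp_minus divide_inverse)
  also have "\<dots> = ennreal \<bar>k\<bar> * (\<integral>\<^sup>+t. ennreal (indicator {0<..} (0 + k * t) * (0 + k * t) powr (s - 1) * exp (- (0 + k * t))) \<partial>lborel)"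
    using k by (subst nn_integral_real_affine[of _ k 0]) auto
  also have "\<dots> = (\<integral>\<^sup>+t. ennreal (k powr s) * ennreal (indicator {0<..} t * t powr (s - 1) * exp (- k * t)) \<partial>lborel)"
    using k by (subst nn_integral_cmult[symmetric]) (auto intro!: nn_integral_cong
      simp: indicator_def zero_less_mult_iff powr_mult powr_diff mult_ac simp flip: ennreal_mult')
  also have "\<dots> = ennreal (k powr s) * (\<integral>\<^sup>+t. ennreal (indicator {0<..} t * t powr (s - 1) * exp (- k * t)) \<partial>lborel)"
    by (rule nn_integral_cmult) simp
  finally have "ennreal (k powr (- s)) * ennreal (Gamma s) =
     ennreal (k powr (- s)) * ennreal (k powr s) * (\<integral>\<^sup>+t. ennreal (indicator {0<..} t * t powr (s - 1) * exp (- k * t)) \<partial>lborel)"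
    by (simp add: mult.assoc)
  also have "ennreal (k powr (- s)) * ennreal (k powr s) = 1"
    using k by (simp add: powr_add[symmetric] flip: ennreal_mult')
  finally show ?thesis using s k by (simp add: mult_ac flip: ennreal_mult')
qed

text \<open>The factor \<open>(1 + c * t) powr (- s)\<close> is written as a Gamma integral over
  \<open>u\<close>. After exchanging the integrals both are Gamma integrals; the one over
  \<open>u\<close> has the exponent \<open>s - p\<close>, whence the condition
  \<open>p < s\<close>.\<close>

lemma nn_integral_Beta_scaled:
  fixes p s c :: real
  assumes p: "0 < p" "p < s" and c: "c > 0"
  shows "(\<integral>\<^sup>+t. ennreal (indicator {0<..} t * t powr (p - 1) * (1 + c * t) powr (- s)) \<partial>lborel) =
    ennreal (Gamma p * Gamma (s - p) / Gamma s * c powr (- p))"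
proof -
  have s: "s > 0" using p by simp
  let ?h = "\<lambda>t u :: real. ennreal (indicator {0<..} t * t powr (p - 1) * (indicator {0<..} u * u powr (s - 1) * exp (- (1 + c * t) * u)))"
  have "ennreal (Gamma s) * (\<integral>\<^sup>+t. ennreal (indicator {0<..} t * t powr (p - 1) * (1 + c * t) powr (- s)) \<partial>lborel) =
     (\<integral>\<^sup>+t. \<integral>\<^sup>+u. ?h t u \<partial>lborel \<partial>lborel)"
  proof (subst nn_integral_cmult[symmetric], simp, rule nn_integral_cong)
    fix t :: real
    show "ennreal (Gamma s) * ennreal (indicator {0<..} t * t powr (p - 1) * (1 + c * t) powr (- s)) =
      (\<integral>\<^sup>+u. ?h t u \<partial>lborel)"
    proof (cases "t > 0")
      case True
      then have k: "1 + c * t > 0" using c by (simp add: add_pos_pos)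
      have "(\<integral>\<^sup>+u. ?h t u \<partial>lborel) = ennreal (t powr (p - 1)) *
          (\<integral>\<^sup>+u. ennreal (indicator {0<..} u * u powr (s - 1) * exp (- (1 + c * t) * u)) \<partial>lborel)"
        using True by (subst nn_integral_cmult[symmetric]) (auto simp flip: ennreal_mult')
      then show ?thesis
        unfolding nn_integral_Gamma_scaled[OF s k] using True s
        by (simp add: mult_ac flip: ennreal_mult')
    qed simp
  qed
  also have "\<dots> = (\<integral>\<^sup>+u. \<integral>\<^sup>+t. ?h t u \<partial>lborel \<partial>lborel)"
    by (rule lborel_pair.Fubini') simp
  also have "\<dots> = (\<integral>\<^sup>+u. ennreal (Gamma p * c powr (- p)) *
      ennreal (indicator {0<..} u * u powr (s - p - 1) * exp (- 1 * u)) \<partial>lborel)"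
  proof (rule nn_integral_cong)
    fix u :: real
    show "(\<integral>\<^sup>+t. ?h t u \<partial>lborel) = ennreal (Gamma p * c powr (- p)) *
      ennreal (indicator {0<..} u * u powr (s - p - 1) * exp (- 1 * u))"
    proof (cases "u > 0")
      case True
      then have k: "c * u > 0" using c by simp
      have "(\<integral>\<^sup>+t. ?h t u \<partial>lborel) = (\<integral>\<^sup>+t. ennreal (u powr (s - 1) * exp (- u)) *
          ennreal (indicator {0<..} t * t powr (p - 1) * exp (- (c * u) * t)) \<partial>lborel)"
        using True by (intro nn_integral_cong)
          (auto simp: ring_distribs exp_add mult_ac exp_diff exp_minus field_simps simp flip: ennreal_mult')
      also have "\<dots> = ennreal (u powr (s - 1) * exp (- u)) * ennreal (Gamma p * (c * u) powr (- p))"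
        by (subst nn_integral_cmult) (simp_all only: nn_integral_Gamma_scaled[OF p(1) k], simp)
      also have "\<dots> = ennreal (Gamma p * c powr (- p)) * ennreal (u powr (s - p - 1) * exp (- 1 * u))"
      proof -
        have "u powr (s - 1) * u powr (- p) = u powr (s - p - 1)"
          by (simp add: powr_add[symmetric] algebra_simps)
        then have "u powr (s - 1) * exp (- u) * (Gamma p * (c * u) powr (- p)) =
           Gamma p * c powr (- p) * (u powr (s - p - 1) * exp (- 1 * u))"
          using True c by (simp add: powr_mult mult_ac)
        then show ?thesis using p by (simp flip: ennreal_mult')
      qed
      finally show ?thesis using True by simp
    qed simp
  qed
  also have "\<dots> = ennreal (Gamma p * c powr (- p)) * ennreal (Gamma (s - p))"
    using nn_integral_Gamma_scaled[of "s - p" 1] p by (subst nn_integral_cmult) auto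
  finally have "ennreal (1 / Gamma s) * ennreal (Gamma s) *
      (\<integral>\<^sup>+t. ennreal (indicator {0<..} t * t powr (p - 1) * (1 + c * t) powr (- s)) \<partial>lborel) =
     ennreal (1 / Gamma s) * (ennreal (Gamma p * c powr (- p)) * ennreal (Gamma (s - p)))"
    by (simp only: mult.assoc)
  moreover have "ennreal (1 / Gamma s) * ennreal (Gamma s) = 1"
    using Gamma_real_pos[OF s] by (simp flip: ennreal_mult')
  moreover have "ennreal (1 / Gamma s) * (ennreal (Gamma p * c powr (- p)) * ennreal (Gamma (s - p))) =
      ennreal (Gamma p * Gamma (s - p) / Gamma s * c powr (- p))"
    using p s by (simp add: mult_ac flip: ennreal_mult')
  ultimately show ?thesis by simp
qed

text \<open>For \<alpha> < N this is the moment of order -\<alpha> of the norm of a Gaussian vector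
  with density \<open>heat_kernel 1\<close>, that is, with covariance twice the identity.\<close>

definition riesz_const :: "nat \<Rightarrow> real \<Rightarrow> real" where
  "riesz_const N \<alpha> = Gamma ((real N - \<alpha>) / 2) / Gamma (real N / 2) * 4 powr (- (\<alpha> / 2))"

text \<open>All integrands are nonnegative, so the exchanges are instances of Tonelli's theorem and
  finiteness is part of the result. The condition \<alpha> < N is the convergence condition of the
  Beta integral with \<open>p = \<alpha> / 2\<close> and \<open>s = N / 2\<close>. The factor
  \<open>Gamma (\<alpha> / 2)\<close> stays on the left until it can be cancelled.\<close>

lemma nn_integral_heat_kernel_riesz:
  fixes a b \<alpha> :: real
  assumes a: "a > 0" and b: "b > 0" and \<alpha>: "0 < \<alpha>" "\<alpha> < real CARD('N)"
  shows "(\<integral>\<^sup>+x. \<integral>\<^sup>+y. ennreal (heat_kernel a x * heat_kernel b y * norm (x - y :: real^'N) powr (- \<alpha>)) \<partial>lborel \<partial>lborel) =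
    ennreal (riesz_const CARD('N) \<alpha> * (a + b) powr (- (\<alpha> / 2)))"
proof -
  let ?N = "real CARD('N)"
  let ?w = "\<lambda>l::real. indicator {0<..} l * l powr (\<alpha> / 2 - 1)"
  let ?h = "\<lambda>(x::real^'N) y l. ennreal (?w l * (heat_kernel a x * heat_kernel b y * exp (- l * (norm (x - y))\<^sup>2)))"
  have "ennreal (Gamma (\<alpha> / 2)) * (\<integral>\<^sup>+x. \<integral>\<^sup>+y. ennreal (heat_kernel a x * heat_kernel b y * norm (x - y :: real^'N) powr (- \<alpha>)) \<partial>lborel \<partial>lborel) =
     (\<integral>\<^sup>+x. \<integral>\<^sup>+y. \<integral>\<^sup>+l. ?h x y l \<partial>lborel \<partial>lborel \<partial>lborel)"
  proof (subst nn_integral_cmult[symmetric], simp, rule nn_integral_cong, subst nn_integral_cmult[symmetric], simp, rule nn_integral_cong_AE)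
    fix x :: "real^'N"
    \<comment> \<open>At \<open>y = x\<close> the left-hand side is 0 because \<open>0 powr (- \<alpha>) = 0\<close>, whence only AE.\<close>
    show "AE y in lborel. ennreal (Gamma (\<alpha> / 2)) * ennreal (heat_kernel a x * heat_kernel b y * norm (x - y) powr (- \<alpha>)) =
        (\<integral>\<^sup>+l. ?h x y l \<partial>lborel)"
      using AE_lborel_singleton[of x]
    proof eventually_elim
      case (elim y)
      then have k: "(norm (x - y))\<^sup>2 > 0" by simp
      have "(\<integral>\<^sup>+l. ?h x y l \<partial>lborel) = ennreal (heat_kernel a x * heat_kernel b y) *
         (\<integral>\<^sup>+l. ennreal (indicator {0<..} l * l powr (\<alpha> / 2 - 1) * exp (- (norm (x - y))\<^sup>2 * l)) \<partial>lborel)"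
        by (subst nn_integral_cmult[symmetric]) (auto simp: heat_kernel_nonneg mult_ac simp flip: ennreal_mult')
      also have "\<dots> = ennreal (heat_kernel a x * heat_kernel b y) * ennreal (Gamma (\<alpha> / 2) * (norm (x - y))\<^sup>2 powr (- (\<alpha> / 2)))"
        using nn_integral_Gamma_scaled[OF _ k, of "\<alpha> / 2"] \<alpha> by simp
      also have "(norm (x - y))\<^sup>2 powr (- (\<alpha> / 2)) = norm (x - y) powr (- \<alpha>)"
        using powr_powr[of "norm (x - y)" 2 "- (\<alpha> / 2)"] by simp
      finally show ?case
        using \<alpha> by (simp add: heat_kernel_nonneg mult_ac flip: ennreal_mult')
    qed
  qed
  also have "\<dots> = (\<integral>\<^sup>+x. \<integral>\<^sup>+l. \<integral>\<^sup>+y. ?h x y l \<partial>lborel \<partial>lborel \<partial>lborel)"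
    by (intro nn_integral_cong lborel_pair.Fubini') simp
  also have "\<dots> = (\<integral>\<^sup>+l. \<integral>\<^sup>+x. \<integral>\<^sup>+y. ?h x y l \<partial>lborel \<partial>lborel \<partial>lborel)"
    by (intro lborel_pair.Fubini') simp
  also have "\<dots> = (\<integral>\<^sup>+l. ennreal (indicator {0<..} l * l powr (\<alpha> / 2 - 1) * (1 + 4 * (a + b) * l) powr (- (?N / 2))) \<partial>lborel)"
  proof (rule nn_integral_cong)
    fix l :: real
    show "(\<integral>\<^sup>+x. \<integral>\<^sup>+y. ?h x y l \<partial>lborel \<partial>lborel) =
       ennreal (indicator {0<..} l * l powr (\<alpha> / 2 - 1) * (1 + 4 * (a + b) * l) powr (- (?N / 2)))"
    proof (cases "l > 0")
      case True
      have "(\<integral>\<^sup>+x. \<integral>\<^sup>+y. ?h x y l \<partial>lborel \<partial>lborel) = ennreal (?w l) *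
        (\<integral>\<^sup>+x. \<integral>\<^sup>+y. ennreal (heat_kernel a x * heat_kernel b y * exp (- l * (norm (x - y :: real^'N))\<^sup>2)) \<partial>lborel \<partial>lborel)"
        by (simp add: ennreal_mult' nn_integral_cmult)
      then show ?thesis
        unfolding nn_integral_heat_kernel_heat_kernel_gauss[OF a b True] by (simp flip: ennreal_mult')
    qed simp
  qed
  also have "\<dots> = ennreal (Gamma (\<alpha> / 2) * Gamma (?N / 2 - \<alpha> / 2) / Gamma (?N / 2) * (4 * (a + b)) powr (- (\<alpha> / 2)))"
    using a b \<alpha> by (intro nn_integral_Beta_scaled) auto
  also have "\<dots> = ennreal (Gamma (\<alpha> / 2)) * ennreal (riesz_const CARD('N) \<alpha> * (a + b) powr (- (\<alpha> / 2)))"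
  proof -
    have "(4 * (a + b)) powr (- (\<alpha> / 2)) = 4 powr (- (\<alpha> / 2)) * (a + b) powr (- (\<alpha> / 2))"
      by (rule powr_mult)
    then show ?thesis
      using \<alpha> by (simp add: riesz_const_def diff_divide_distrib mult_ac del: distrib_left_numeral flip: ennreal_mult')
  qed
  finally show ?thesis
    using Gamma_real_pos[OF half_gt_zero[OF \<alpha>(1)]] by (subst (asm) ennreal_mult_cancel_left) auto
qed

text \<open>The counterpart for white noise in space, where the value is
  \<open>heat_kernel (a + b) 0\<close>. One of the kernels is itself a Gaussian factor, with
  parameter \<open>1 / (4 * b)\<close>.\<close>

lemma nn_integral_heat_kernel_mult:
  assumes a: "a > 0" and b: "b > 0"
  shows "(\<integral>\<^sup>+x. ennreal (heat_kernel a x * heat_kernel b (x :: real^'N)) \<partial>lborel) =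
    ennreal ((4 * pi * (a + b)) powr (- (real CARD('N) / 2)))"
proof -
  define l where "l = 1 / (4 * b)"
  have l: "l > 0" using b by (simp add: l_def)
  let ?c = "(4 * pi * b) powr (- (real CARD('N) / 2))"
  have "(\<integral>\<^sup>+x. ennreal (heat_kernel a x * heat_kernel b (x :: real^'N)) \<partial>lborel) =
     ennreal ?c * (\<integral>\<^sup>+x. ennreal (heat_kernel a x * exp (- l * (norm (0 - x :: real^'N))\<^sup>2)) \<partial>lborel)"
    using b by (subst nn_integral_cmult[symmetric])
      (auto intro!: nn_integral_cong simp: heat_kernel_def[of b] l_def heat_kernel_nonneg mult_ac simp flip: ennreal_mult')
  also have "\<dots> = ennreal ((4 * pi * b * (1 + 4 * a * l)) powr (- (real CARD('N) / 2)))"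
    unfolding nn_integral_heat_kernel_gauss[OF a l] using a b l
    by (simp add: powr_mult flip: ennreal_mult')
  also have "4 * pi * b * (1 + 4 * a * l) = 4 * pi * (a + b)"
    using b by (simp add: l_def field_simps)
  finally show ?thesis .
qed


section \<open>The covariance of the pinned string\<close>

text \<open>The bound has to consist of heat kernels, since their pairings are explicit. Where the
  kernel at time \<open>a\<close> is larger, the exponentials help and only the prefactors are
  compared. In the other direction the exponents differ by a multiple of \<open>z\<close>, which
  half of the exponential absorbs; the other half belongs to time \<open>2 * b\<close>. The constant
  8 is a factor 2 from this splitting times the bound 4 for \<open>2 * b / a\<close>.\<close>

lemma heat_kernel_diff_bound:
  fixes x :: "real^'N"
  assumes N: "CARD('N) \<le> 2" and ab: "0 < a" "a \<le> b" "b \<le> 2 * a"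
  shows "\<bar>heat_kernel b x - heat_kernel a x\<bar> \<le> (b - a) / a * (heat_kernel b x + 8 * heat_kernel (2 * b) x)"
proof -
  define n where "n = real CARD('N) / 2"
  define z where "z = (norm x)\<^sup>2 / 4"
  have n: "0 < n" "n \<le> 1" using N by (auto simp: n_def)
  have z: "z \<ge> 0" by (simp add: z_def)
  have b: "b > 0" using ab by simp
  have k: "heat_kernel c x = (4 * pi * c) powr (- n) * exp (- z / c)" if "c > 0" for c
    using that by (simp add: heat_kernel_def n_def z_def)
  \<comment> \<open>The power \<open>n\<close> is at most 1 because the dimension is at most 2, so a
    ratio at least 1 to the power \<open>n\<close> is bounded by the ratio itself.\<close>
  have ratio: "(4 * pi * a) powr (- n) \<le> d / a * (4 * pi * d) powr (- n)" if "a \<le> d" for d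
  proof -
    have d: "d > 0" using that ab by simp
    have "(4 * pi * a) powr (- n) = (d / a) powr n * (4 * pi * d) powr (- n)"
      using ab d by (simp add: powr_minus powr_divide powr_mult divide_simps)
    moreover have "(d / a) powr n \<le> (d / a) powr 1"
      using that ab n by (intro powr_mono) auto
    ultimately show ?thesis
      using mult_right_mono[of "(d / a) powr n" "(d / a) powr 1" "(4 * pi * d) powr (- n)"] ab d by simp
  qed
  have za: "exp (- z / a) \<le> exp (- z / b)"
    using ab z by (simp add: frac_le)
  have "heat_kernel a x - heat_kernel b x \<le> (b - a) / a * heat_kernel b x"
  proof -
    have "heat_kernel a x \<le> (b / a * (4 * pi * b) powr (- n)) * exp (- z / b)"
      unfolding k[OF ab(1)] using ratio[OF ab(2)] za ab b by (intro mult_mono) auto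
    also have "\<dots> = b / a * heat_kernel b x" using k[OF b] by simp
    finally show ?thesis using ab by (simp add: field_simps)
  qed
  moreover have "heat_kernel b x - heat_kernel a x \<le> (b - a) / a * (8 * heat_kernel (2 * b) x)"
  proof -
    define w where "w = z / a - z / b"
    have "(4 * pi * b) powr (- n) \<le> (4 * pi * a) powr (- n)"
      using ab n by (intro powr_mono2') auto
    then have "heat_kernel b x - heat_kernel a x \<le> (4 * pi * a) powr (- n) * (exp (- z / b) - exp (- z / a))"
      using k[OF ab(1)] k[OF b] by (simp add: right_diff_distrib mult_right_mono)
    also have "exp (- z / b) - exp (- z / a) = exp (- z / b) * (1 - exp (- w))"
      by (simp add: w_def right_diff_distrib exp_diff exp_minus field_simps)
    also have "\<dots> \<le> exp (- z / b) * w"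
      using exp_ge_add_one_self[of "- w"] by (intro mult_left_mono) auto
    \<comment> \<open>The linear factor \<open>z / (2 * b)\<close> is grouped with one of two equal
      exponentials, to be removed by \<open>exp (- y) * y \<le> 1\<close>.\<close>
    also have "\<dots> = exp (- z / (2 * b)) * (2 * (b - a) / a) * (exp (- z / (2 * b)) * (z / (2 * b)))"
    proof -
      have "w = 2 * (b - a) / a * (z / (2 * b))"
        using ab b by (simp add: w_def field_simps)
      moreover have "exp (- z / b) = exp (- z / (2 * b)) * exp (- z / (2 * b))"
        by (simp add: exp_add[symmetric])
      ultimately show ?thesis by simp
    qed
    also have "\<dots> \<le> exp (- z / (2 * b)) * (2 * (b - a) / a) * 1"
    proof (intro mult_left_mono)
      have "exp (- y) * y \<le> 1" for y :: real
      proof -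
        have "y \<le> exp y" using exp_ge_add_one_self[of y] by linarith
        then show ?thesis by (simp add: exp_minus field_simps)
      qed
      from this[of "z / (2 * b)"] show "exp (- z / (2 * b)) * (z / (2 * b)) \<le> 1"
        by (simp only: minus_divide_left)
    qed (use ab in simp)
    finally have "heat_kernel b x - heat_kernel a x \<le> (4 * pi * a) powr (- n) * (exp (- z / (2 * b)) * (2 * (b - a) / a))"
      by (simp add: mult_left_mono)
    also have "\<dots> \<le> (4 * (4 * pi * (2 * b)) powr (- n)) * (exp (- z / (2 * b)) * (2 * (b - a) / a))"
    proof (rule mult_right_mono)
      have "(4 * pi * a) powr (- n) \<le> (2 * b) / a * (4 * pi * (2 * b)) powr (- n)"
        using ab by (intro ratio) simp
      also have "\<dots> \<le> 4 * (4 * pi * (2 * b)) powr (- n)"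
        using ab by (intro mult_right_mono) (auto simp: field_simps)
      finally show "(4 * pi * a) powr (- n) \<le> 4 * (4 * pi * (2 * b)) powr (- n)" .
    qed (use ab in simp)
    also have "\<dots> = (b - a) / a * (8 * heat_kernel (2 * b) x)"
      using k[of "2 * b"] b by simp
    finally show ?thesis .
  qed
  moreover have "0 \<le> (b - a) / a * heat_kernel b x" "0 \<le> (b - a) / a * (8 * heat_kernel (2 * b) x)"
    using ab by (simp_all add: heat_kernel_nonneg)
  ultimately show ?thesis by (simp add: distrib_left)
qed

section \<open>One-dimensional integrals of powers\<close>

lemma powr_add_diff_tendsto_0:
  fixes p c :: real
  assumes "0 < p" "p < 1"
  shows "((\<lambda>x. (x + c) powr p - x powr p) \<longlongrightarrow> 0) at_top"
  using assms by real_asymp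

text \<open>For \<open>p < 1\<close> and \<open>2 * r = c\<close> the integrand is singular at
  \<open>r\<close>. The antiderivative is still continuous there as \<open>p > 0\<close>, and for a
  nonnegative integrand one-sided limits of the antiderivative at the endpoints suffice.\<close>

lemma set_integral_powr:
  fixes c l r p :: real
  assumes p: "0 < p" and lr: "l < r" "2 * r \<le> c"
  shows "set_integrable lborel {l<..<r} (\<lambda>u. (c - 2 * u) powr (p - 1))"
    and "(LINT u:{l<..<r}|lborel. (c - 2 * u) powr (p - 1)) = ((c - 2 * l) powr p - (c - 2 * r) powr p) / (2 * p)"
proof -
  let ?F = "\<lambda>u. - ((c - 2 * u) powr p / (2 * p))"
  have 1: "DERIV ?F u :> (c - 2 * u) powr (p - 1)" if "u < r" for u
    using that lr p by (auto intro!: derivative_eq_intros simp: field_simps)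
  have 2: "isCont (\<lambda>u. (c - 2 * u) powr (p - 1)) u" if "u < r" for u
    using that lr by (intro continuous_intros) auto
  have cont: "continuous_on {l..r} ?F"
    using p lr by (intro continuous_intros continuous_on_powr') auto
  then have "continuous (at l within {l..r}) ?F" "continuous (at r within {l..r}) ?F"
    using lr by (auto simp: continuous_on_eq_continuous_within)
  then have 3: "((?F \<circ> real_of_ereal) \<longlongrightarrow> ?F l) (at_right (ereal l))"
     "((?F \<circ> real_of_ereal) \<longlongrightarrow> ?F r) (at_left (ereal r))"
    using lr by (auto simp: ereal_tendsto_simps continuous_within at_within_Icc_at_right at_within_Icc_at_left)
  have FTC: "set_integrable lborel (einterval (ereal l) (ereal r)) (\<lambda>u. (c - 2 * u) powr (p - 1))"
    "(LBINT u=ereal l..ereal r. (c - 2 * u) powr (p - 1)) = ?F r - ?F l"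
    by (rule interval_integral_FTC_nonneg[OF _ _ _ _ 3]; use lr 1 2 in simp)+
  have e: "einterval (ereal l) (ereal r) = {l<..<r}" by (auto simp: einterval_def)
  show "set_integrable lborel {l<..<r} (\<lambda>u. (c - 2 * u) powr (p - 1))"
    using FTC(1) by (simp only: e)
  show "(LINT u:{l<..<r}|lborel. (c - 2 * u) powr (p - 1)) = ((c - 2 * l) powr p - (c - 2 * r) powr p) / (2 * p)"
    using FTC(2) lr unfolding interval_lebesgue_integral_def e by (simp add: diff_divide_distrib)
qed

text \<open>None of the four powers is integrable at minus infinity; their second difference is. It
  is nonnegative by convexity, so limits of the antiderivative at both ends give integrability
  together with the value.\<close>

lemma set_integral_powr_second_diff:
  fixes s t p :: real
  assumes p: "0 < p" "p < 1" and st: "0 \<le> s" "0 \<le> t"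
  defines "h \<equiv> \<lambda>u. (s + t - 2 * u) powr (p - 1) - (s - 2 * u) powr (p - 1) - (t - 2 * u) powr (p - 1) + (- 2 * u) powr (p - 1)"
  shows "set_integrable lborel {..<0} h"
    and "(LINT u:{..<0}|lborel. h u) = (s powr p + t powr p - (s + t) powr p) / (2 * p)"
proof -
  let ?F = "\<lambda>u. - ((s + t - 2 * u) powr p - (s - 2 * u) powr p - (t - 2 * u) powr p + (- 2 * u) powr p) / (2 * p)"
  have 1: "DERIV ?F u :> h u" if "u < 0" for u
    unfolding h_def using that st p by (auto intro!: derivative_eq_intros simp: field_simps)
  have 2: "isCont h u" if "u < 0" for u
    unfolding h_def using that st by (intro continuous_intros) auto
  have 3: "0 \<le> h u" if u: "u < 0" for u
  proof -
    \<comment> \<open>The drop of the convex decreasing function \<open>m powr (p - 1)\<close> over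
      a step \<open>s\<close> shrinks as \<open>m\<close> grows from \<open>- 2 * u\<close> to
      \<open>t - 2 * u\<close>.\<close>
    have "(t - 2 * u) powr (p - 1) - (t - 2 * u + s) powr (p - 1) \<le> (- 2 * u) powr (p - 1) - (- 2 * u + s) powr (p - 1)"
    proof (rule DERIV_nonpos_imp_nonincreasing[where f = "\<lambda>m. m powr (p - 1) - (m + s) powr (p - 1)"])
      show "- 2 * u \<le> t - 2 * u" using st by simp
      fix m assume m: "- 2 * u \<le> m"
      then have m0: "0 < m" using u by linarith
      have "DERIV (\<lambda>m. m powr (p - 1) - (m + s) powr (p - 1)) m :> (p - 1) * (m powr (p - 1 - 1) - (m + s) powr (p - 1 - 1))"
        using m0 st by (auto intro!: derivative_eq_intros simp: algebra_simps)
      moreover have "(m + s) powr (p - 1 - 1) \<le> m powr (p - 1 - 1)"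
        using m0 st p by (intro powr_mono2') auto
      then have "(p - 1) * (m powr (p - 1 - 1) - (m + s) powr (p - 1 - 1)) \<le> 0"
        using p by (intro mult_nonpos_nonneg) auto
      ultimately show "\<exists>y. DERIV (\<lambda>m. m powr (p - 1) - (m + s) powr (p - 1)) m :> y \<and> y \<le> 0" by blast
    qed
    then show ?thesis by (simp add: h_def algebra_simps)
  qed
  \<comment> \<open>The endpoint -1 is arbitrary; the aim is the left limit of \<open>?F\<close> at
    0.\<close>
  have c: "continuous_on {-1..0} (\<lambda>u. (k - 2 * u) powr p)" if "k \<ge> 0" for k
    using p that by (intro continuous_on_powr' continuous_intros) auto
  have c0: "continuous_on {-1..0} (\<lambda>u. (- 2 * u) powr p)"
    using c[of 0] by simp
  have "continuous_on {-1..0} ?F"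
    using st p by (intro continuous_on_divide continuous_on_minus continuous_on_add continuous_on_diff
      continuous_on_const c c0) auto
  then have "continuous (at 0 within {-1..0}) ?F"
    by (auto simp: continuous_on_eq_continuous_within)
  then have 4: "((?F \<circ> real_of_ereal) \<longlongrightarrow> ?F 0) (at_left (ereal 0))"
    by (simp only: ereal_tendsto_simps) (simp add: continuous_within at_within_Icc_at_left)
  \<comment> \<open>With \<open>x = - 2 * u\<close> the powers are grouped into two increments of
    \<open>x powr p\<close> over a step \<open>s\<close>. Each tends to 0 since
    \<open>p < 1\<close>, although the single powers diverge.\<close>
  have lim: "((\<lambda>x. - (((x + t) + s) powr p - (x + t) powr p - ((x + s) powr p - x powr p)) / (2 * p)) \<longlongrightarrow> - (0 - 0) / (2 * p)) at_top"
  proof (intro tendsto_intros)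
    have "filterlim (\<lambda>x::real. x + t) at_top at_top" by real_asymp
    from filterlim_compose[OF powr_add_diff_tendsto_0[OF p, of s] this]
    show "((\<lambda>x. ((x + t) + s) powr p - (x + t) powr p) \<longlongrightarrow> 0) at_top" .
    show "((\<lambda>x. (x + s) powr p - x powr p) \<longlongrightarrow> 0) at_top"
      by (rule powr_add_diff_tendsto_0[OF p])
  qed (use p in auto)
  have "filterlim (\<lambda>u::real. - 2 * u) at_top at_bot" by real_asymp
  from filterlim_compose[OF lim this]
  have "(?F \<longlongrightarrow> 0) at_bot"
    by (simp add: algebra_simps)
  then have 5: "((?F \<circ> real_of_ereal) \<longlongrightarrow> 0) (at_right (-\<infinity>))"
    by (simp only: ereal_tendsto_simps)
  have FTC: "set_integrable lborel (einterval (-\<infinity>) (ereal 0)) h" "(LBINT u=-\<infinity>..ereal 0. h u) = ?F 0 - 0"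
    by (rule interval_integral_FTC_nonneg[OF _ _ _ _ 5 4]; use 1 2 3 in \<open>simp flip: zero_ereal_def\<close>)+
  have e: "einterval (-\<infinity>) (ereal 0) = {..<0}" by (auto simp: einterval_def)
  show "set_integrable lborel {..<0} h"
    using FTC(1) by (simp only: e)
  show "(LINT u:{..<0}|lborel. h u) = (s powr p + t powr p - (s + t) powr p) / (2 * p)"
    using FTC(2) p unfolding interval_lebesgue_integral_def e by (simp add: field_simps)
qed

lemma set_integrable_inverse_square:
  fixes t :: real
  assumes "t > 0"
  shows "set_integrable lborel {..<- t} (\<lambda>u. 1 / u\<^sup>2)"
proof -
  have "((\<lambda>u::real. - 1 / u) \<longlongrightarrow> 0) at_bot" by real_asymp
  then have 5: "(((\<lambda>u::real. - 1 / u) \<circ> real_of_ereal) \<longlongrightarrow> 0) (at_right (-\<infinity>))"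
    by (simp only: ereal_tendsto_simps)
  have "((\<lambda>u::real. - 1 / u) \<longlongrightarrow> - 1 / (- t)) (at_left (- t))"
    using assms by (intro tendsto_intros) auto
  then have 4: "(((\<lambda>u::real. - 1 / u) \<circ> real_of_ereal) \<longlongrightarrow> - 1 / (- t)) (at_left (ereal (- t)))"
    by (simp only: ereal_tendsto_simps)
  have "set_integrable lborel (einterval (-\<infinity>) (ereal (- t))) (\<lambda>u. 1 / u\<^sup>2)"
    by (rule interval_integral_FTC_nonneg(1)[OF _ _ _ _ 5 4])
      (use assms in \<open>auto intro!: derivative_eq_intros continuous_intros simp: power2_eq_square\<close>)
  moreover have "einterval (-\<infinity>) (ereal (- t)) = {..<- t}" by (auto simp: einterval_def)
  ultimately show ?thesis by simp
qed

section \<open>The noise on a single time slice\<close>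

definition admissible :: "nat \<Rightarrow> real \<Rightarrow> bool" where
  "admissible N \<alpha> \<longleftrightarrow> (N = 1 \<and> 0 < \<alpha> \<and> \<alpha> \<le> 1) \<or> (N = 2 \<and> 1 < \<alpha> \<and> \<alpha> < 2)"

text \<open>The measure on pairs of points representing \<open>Q\<close> on a single time slice.\<close>

definition noise_measure :: "real \<Rightarrow> ((real^'N) \<times> (real^'N)) measure" where
  "noise_measure \<alpha> =
     (if \<alpha> = 1 then distr lborel (borel \<Otimes>\<^sub>M borel) (\<lambda>x. (x, x))
      else density (lborel \<Otimes>\<^sub>M lborel) (\<lambda>p. ennreal (norm (fst p - snd p) powr (- \<alpha>))))"

text \<open>The slice pairing of two heat kernels whose times add up to 1. For \<alpha> = 1
  admissibility forces dimension 1, whence the exponent -1/2.\<close>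

definition heat_const :: "nat \<Rightarrow> real \<Rightarrow> real" where
  "heat_const N \<alpha> = (if \<alpha> = 1 then (4 * pi) powr (- (1 / 2)) else riesz_const N \<alpha>)"

definition heat_cov :: "nat \<Rightarrow> real \<Rightarrow> real \<Rightarrow> real \<Rightarrow> real" where
  "heat_cov N \<alpha> a b = (if a > 0 \<and> b > 0 then heat_const N \<alpha> * (a + b) powr (- (\<alpha> / 2)) else 0)"

lemma sets_noise_measure[measurable_cong, simp]:
  "sets (noise_measure \<alpha> :: ((real^'N) \<times> (real^'N)) measure) = sets (borel \<Otimes>\<^sub>M borel)"
proof -
  have "sets (lborel \<Otimes>\<^sub>M lborel :: ((real^'N) \<times> (real^'N)) measure) = sets (borel \<Otimes>\<^sub>M borel)"
    by (rule sets_pair_measure_cong) simp_all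
  then show ?thesis by (simp add: noise_measure_def)
qed

lemma nn_integral_noise_measure:
  assumes [measurable]: "F \<in> borel_measurable (borel \<Otimes>\<^sub>M borel)"
  shows "(\<integral>\<^sup>+p. F p \<partial>noise_measure \<alpha>) =
    (if \<alpha> = 1 then \<integral>\<^sup>+x. F (x, x) \<partial>lborel
     else \<integral>\<^sup>+x. \<integral>\<^sup>+y. ennreal (norm (x - y :: real^'N) powr (- \<alpha>)) * F (x, y) \<partial>lborel \<partial>lborel)"
proof (cases "\<alpha> = 1")
  case True
  then show ?thesis by (simp add: noise_measure_def nn_integral_distr)
next
  case False
  have "(\<integral>\<^sup>+p. F p \<partial>noise_measure \<alpha>) =
     (\<integral>\<^sup>+p. ennreal (norm (fst p - snd p) powr (- \<alpha>)) * F p \<partial>(lborel \<Otimes>\<^sub>M lborel))"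
    using False by (simp add: noise_measure_def nn_integral_density)
  also have "\<dots> = (\<integral>\<^sup>+x. \<integral>\<^sup>+y. ennreal (norm (x - y) powr (- \<alpha>)) * F (x, y) \<partial>lborel \<partial>lborel)"
    by (subst lborel.nn_integral_fst[symmetric]) simp_all
  finally show ?thesis using False by simp
qed

text \<open>Produces the iterated integrals of which \<open>noise_cov\<close> consists;
  \<open>F\<close> has no sign, so Fubini's theorem rests on its integrability.\<close>

lemma integral_noise_measure:
  fixes F :: "(real^'N) \<times> (real^'N) \<Rightarrow> real"
  assumes [measurable]: "integrable (noise_measure \<alpha>) F"
  shows "(LINT p|noise_measure \<alpha>. F p) =
    (if \<alpha> = 1 then LINT x|lborel. F (x, x)
     else LINT x|lborel. LINT y|lborel. norm (x - y) powr (- \<alpha>) * F (x, y))"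
proof (cases "\<alpha> = 1")
  case True
  have "F \<in> borel_measurable (borel \<Otimes>\<^sub>M borel)"
    using borel_measurable_integrable[OF assms] by simp
  with True show ?thesis by (simp add: noise_measure_def integral_distr)
next
  case False
  have [measurable]: "F \<in> borel_measurable (borel \<Otimes>\<^sub>M borel)"
    using borel_measurable_integrable[OF assms] by simp
  have "integrable (lborel \<Otimes>\<^sub>M lborel) (\<lambda>p. norm (fst p - snd p) powr (- \<alpha>) * F p)"
    using assms False by (simp add: noise_measure_def integrable_density)
  from lborel_pair.integral_fst'[OF this]
  have "(LINT x|lborel. LINT y|lborel. norm (x - y) powr (- \<alpha>) * F (x, y)) =
     (LINT p|(lborel \<Otimes>\<^sub>M lborel). norm (fst p - snd p) powr (- \<alpha>) * F p)"
    by simp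
  also have "\<dots> = (LINT p|noise_measure \<alpha>. F p)"
    using False by (simp add: noise_measure_def integral_density)
  finally show ?thesis using False by simp
qed

lemma admissibleD:
  assumes "admissible N \<alpha>"
  shows "0 < \<alpha>" "\<alpha> < 2" "N \<le> 2" "\<alpha> \<noteq> 1 \<Longrightarrow> \<alpha> < real N" "\<alpha> = 1 \<Longrightarrow> N = 1" "0 < N"
  using assms by (auto simp: admissible_def)

lemma heat_const_nonneg:
  assumes "admissible N \<alpha>"
  shows "0 \<le> heat_const N \<alpha>"
proof (cases "\<alpha> = 1")
  case False
  then show ?thesis
    using admissibleD[OF assms] by (simp add: heat_const_def riesz_const_def)
qed (simp add: heat_const_def)

lemma heat_cov_nonneg: "admissible N \<alpha> \<Longrightarrow> 0 \<le> heat_cov N \<alpha> a b"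
  by (simp add: heat_cov_def heat_const_nonneg)

lemma has_bochner_integral_heat_cov:
  assumes ad: "admissible CARD('N) \<alpha>"
  shows "has_bochner_integral (noise_measure \<alpha>)
    (\<lambda>p :: (real^'N) \<times> (real^'N). heat_kernel a (fst p) * heat_kernel b (snd p)) (heat_cov CARD('N) \<alpha> a b)"
proof (rule has_bochner_integral_nn_integral)
  note adD = admissibleD[OF ad]
  show "(\<integral>\<^sup>+p. ennreal (heat_kernel a (fst p) * heat_kernel b (snd p)) \<partial>(noise_measure \<alpha> :: ((real^'N) \<times> (real^'N)) measure)) =
      ennreal (heat_cov CARD('N) \<alpha> a b)"
  proof (cases "a > 0 \<and> b > 0")
    case False
    then show ?thesis by (auto simp: heat_cov_def heat_kernel_def)
  next
    case True
    show ?thesis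
    proof (cases "\<alpha> = 1")
      case \<alpha>: True
      have "(4 * pi * (a + b)) powr (- (1 / 2)) = (4 * pi) powr (- (1 / 2)) * (a + b) powr (- (1 / 2))"
        by (rule powr_mult)
      then show ?thesis
        using True \<alpha> adD(5) nn_integral_heat_kernel_mult[of a b, where 'N = 'N]
        by (simp add: nn_integral_noise_measure heat_cov_def heat_const_def)
    next
      case \<alpha>: False
      then show ?thesis
        using True adD nn_integral_heat_kernel_riesz[of a b \<alpha>, where 'N = 'N]
        by (simp add: nn_integral_noise_measure heat_cov_def heat_const_def heat_kernel_nonneg mult_ac flip: ennreal_mult)
    qed
  qed
qed (auto simp: heat_kernel_nonneg heat_cov_nonneg[OF ad])

section \<open>The pinned kernel and its covariance\<close>

definition string_kernel :: "real \<Rightarrow> real \<Rightarrow> real^'N \<Rightarrow> real" where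
  "string_kernel t s y = heat_kernel (t - s) y - heat_kernel (- s) y"

definition string_cov :: "nat \<Rightarrow> real \<Rightarrow> real \<Rightarrow> real \<Rightarrow> real \<Rightarrow> real" where
  "string_cov N \<alpha> s t u = heat_cov N \<alpha> (s - u) (t - u) - heat_cov N \<alpha> (s - u) (- u)
     - (heat_cov N \<alpha> (- u) (t - u) - heat_cov N \<alpha> (- u) (- u))"

text \<open>For \<open>s > t\<close> both time arguments are negative and the heat kernels vanish by
  themselves; the reflection of \<open>y\<close> is invisible to the norm.\<close>

lemma pinned_kernel_eq_string_kernel:
  assumes "t \<ge> 0"
  shows "(\<lambda>s y. if s \<le> t then heat_kernel (t - s) (0 - y) - heat_kernel (- s) (- y) else 0) =
    (string_kernel t :: real \<Rightarrow> real^'N \<Rightarrow> real)"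
  using assms by (auto simp: fun_eq_iff string_kernel_def heat_kernel_def)

lemma has_bochner_integral_string_cov:
  assumes ad: "admissible CARD('N) \<alpha>"
  shows "has_bochner_integral (noise_measure \<alpha>)
    (\<lambda>p :: (real^'N) \<times> (real^'N). string_kernel s u (fst p) * string_kernel t u (snd p))
    (string_cov CARD('N) \<alpha> s t u)"
proof -
  have "has_bochner_integral (noise_measure \<alpha>)
    (\<lambda>p :: (real^'N) \<times> (real^'N). (heat_kernel (s - u) (fst p) * heat_kernel (t - u) (snd p) - heat_kernel (s - u) (fst p) * heat_kernel (- u) (snd p))
      - (heat_kernel (- u) (fst p) * heat_kernel (t - u) (snd p) - heat_kernel (- u) (fst p) * heat_kernel (- u) (snd p)))
    (string_cov CARD('N) \<alpha> s t u)"
    unfolding string_cov_def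
    by (intro has_bochner_integral_diff has_bochner_integral_heat_cov ad)
  then show ?thesis
    by (simp add: string_kernel_def algebra_simps)
qed

lemma noise_cov_string_kernel:
  assumes ad: "admissible CARD('N) \<alpha>"
  shows "noise_cov \<alpha> (string_kernel s :: real \<Rightarrow> real^'N \<Rightarrow> real) (string_kernel t) =
    (LINT u|lborel. string_cov CARD('N) \<alpha> s t u)"
proof -
  have "string_cov CARD('N) \<alpha> s t u =
    (if \<alpha> = 1 then LINT x|lborel. string_kernel s u x * string_kernel t u (x :: real^'N)
     else LINT x|lborel. LINT y|lborel. string_kernel s u x * string_kernel t u y * norm (x - y :: real^'N) powr (- \<alpha>))" for u
    using has_bochner_integral_string_cov[OF ad, of s u t]
      integral_noise_measure[of \<alpha> "\<lambda>p :: (real^'N) \<times> (real^'N). string_kernel s u (fst p) * string_kernel t u (snd p)"]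
    by (simp add: has_bochner_integral_iff mult_ac)
  then show ?thesis by (simp add: noise_cov_def)
qed

text \<open>For \<open>s \<le> t\<close>, all four pairings are present at noise times
  \<open>u < 0\<close>, only the one of the times \<open>s - u\<close> and \<open>t - u\<close> for
  \<open>0 < u < s\<close>, and none beyond \<open>s\<close>. The slice exponent
  \<open>- (\<alpha> / 2)\<close> is \<open>p - 1\<close>. Symmetry of \<open>heat_cov\<close>
  settles \<open>s > t\<close>.\<close>

lemma integral_string_cov:
  assumes ad: "admissible N \<alpha>" and st: "0 \<le> s" "0 \<le> t"
  defines "p \<equiv> 1 - \<alpha> / 2"
  shows "(LINT u|lborel. string_cov N \<alpha> s t u) = heat_const N \<alpha> / (2 * p) * (s powr p + t powr p - \<bar>t - s\<bar> powr p)"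
proof -
  have p: "0 < p" "p < 1" using admissibleD[OF ad] by (auto simp: p_def)
  let ?C = "heat_const N \<alpha>"
  have main: "(LINT u|lborel. string_cov N \<alpha> s t u) = ?C / (2 * p) * (s powr p + t powr p - (t - s) powr p)"
    if st: "0 \<le> s" "s \<le> t" for s t
  proof -
    let ?h = "\<lambda>u. (s + t - 2 * u) powr (p - 1) - (s - 2 * u) powr (p - 1) - (t - 2 * u) powr (p - 1) + (- 2 * u) powr (p - 1)"
    let ?g = "\<lambda>u. (s + t - 2 * u) powr (p - 1)"
    have t: "0 \<le> t" using st by simp
    note h = set_integral_powr_second_diff[OF p st(1) t]
    have g: "set_integrable lborel {0<..<s} ?g \<and>
      (LINT u:{0<..<s}|lborel. ?g u) = ((s + t) powr p - (t - s) powr p) / (2 * p)"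
    proof (cases "s = 0")
      case True
      then show ?thesis by (simp add: set_lebesgue_integral_def set_integrable_def)
    next
      case False
      then show ?thesis
        using set_integral_powr[OF p(1), of 0 s "s + t"] st by simp
    qed
    have "AE u in lborel. string_cov N \<alpha> s t u = ?C * (indicator {..<0} u *\<^sub>R ?h u + indicator {0<..<s} u *\<^sub>R ?g u)"
      \<comment> \<open>At \<open>u = 0\<close> both indicators vanish while the slice covariance
        need not.\<close>
      using AE_lborel_singleton[of 0]
    proof eventually_elim
      case (elim u)
      have b: "- (\<alpha> / 2) = p - 1" by (simp add: p_def)
      consider "u < 0" | "0 < u" "u < s" | "u > 0" "s \<le> u" using elim by linarith
      then show ?case
      proof cases
        case 1
        then have "heat_cov N \<alpha> (s - u) (t - u) = ?C * (s + t - 2 * u) powr (p - 1)"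
          "heat_cov N \<alpha> (s - u) (- u) = ?C * (s - 2 * u) powr (p - 1)"
          "heat_cov N \<alpha> (- u) (t - u) = ?C * (t - 2 * u) powr (p - 1)"
          "heat_cov N \<alpha> (- u) (- u) = ?C * (- 2 * u) powr (p - 1)"
          using st by (simp_all add: heat_cov_def b algebra_simps)
        with 1 show ?thesis by (simp add: string_cov_def algebra_simps)
      next
        case 2
        then show ?thesis using st by (simp add: string_cov_def heat_cov_def b algebra_simps)
      next
        case 3
        then show ?thesis using st by (simp add: string_cov_def heat_cov_def)
      qed
    qed
    then have "(LINT u|lborel. string_cov N \<alpha> s t u) =
       (LINT u|lborel. ?C * (indicator {..<0} u *\<^sub>R ?h u + indicator {0<..<s} u *\<^sub>R ?g u))"
      by (intro integral_cong_AE) (auto simp: string_cov_def heat_cov_def)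
    also have "\<dots> = ?C * ((LINT u:{..<0}|lborel. ?h u) + (LINT u:{0<..<s}|lborel. ?g u))"
      using h(1) g unfolding set_lebesgue_integral_def set_integrable_def by simp
    also have "\<dots> = ?C / (2 * p) * (s powr p + t powr p - (t - s) powr p)"
      using p unfolding h(2) g[THEN conjunct2] by (simp add: divide_simps)
    finally show ?thesis .
  qed
  show ?thesis
  proof (cases "s \<le> t")
    case True
    then show ?thesis using main st by simp
  next
    case False
    have c: "heat_cov N \<alpha> a b = heat_cov N \<alpha> b a" for a b
      by (simp add: heat_cov_def add.commute conj_commute)
    have "string_cov N \<alpha> s t u = string_cov N \<alpha> t s u" for u
      unfolding string_cov_def c[of "s - u" "t - u"] c[of "s - u" "- u"] c[of "- u" "t - u"] by simp
    then have "(LINT u|lborel. string_cov N \<alpha> s t u) = ?C / (2 * p) * (t powr p + s powr p - (s - t) powr p)"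
      using False main[of t s] st by simp
    also have "s - t = \<bar>t - s\<bar>" using False by simp
    finally show ?thesis by (simp only: add.commute)
  qed
qed

section \<open>Absolute convergence for the pinned kernel\<close>

text \<open>The measure on pairs is positive, so a pointwise bound on \<open>f\<close> passes to the
  pairing; for a combination of heat kernels the pairing expands into explicit terms.\<close>

lemma nn_integral_noise_measure_bound:
  fixes f :: "real^'N \<Rightarrow> real"
  assumes ad: "admissible CARD('N) \<alpha>" and "0 \<le> r" "0 \<le> m"
    and f: "\<And>x. \<bar>f x\<bar> \<le> r * (heat_kernel a x + m * heat_kernel b x)"
  shows "(\<integral>\<^sup>+p. ennreal \<bar>f (fst p) * f (snd p)\<bar> \<partial>noise_measure \<alpha>) \<le>
    ennreal (r\<^sup>2 * (heat_cov CARD('N) \<alpha> a a + m * heat_cov CARD('N) \<alpha> a b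
      + (m * heat_cov CARD('N) \<alpha> b a + m\<^sup>2 * heat_cov CARD('N) \<alpha> b b)))" (is "_ \<le> ennreal ?R")
proof -
  let ?g = "\<lambda>x. r * (heat_kernel a x + m * heat_kernel b (x :: real^'N))"
  have i: "has_bochner_integral (noise_measure \<alpha>)
    (\<lambda>p :: (real^'N) \<times> (real^'N). r\<^sup>2 * (heat_kernel a (fst p) * heat_kernel a (snd p) + m * (heat_kernel a (fst p) * heat_kernel b (snd p))
      + (m * (heat_kernel b (fst p) * heat_kernel a (snd p)) + m\<^sup>2 * (heat_kernel b (fst p) * heat_kernel b (snd p))))) ?R"
    by (intro has_bochner_integral_add has_bochner_integral_mult_right has_bochner_integral_heat_cov ad)
  have "(\<integral>\<^sup>+p. ennreal \<bar>f (fst p) * f (snd p)\<bar> \<partial>noise_measure \<alpha>) \<le>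
     (\<integral>\<^sup>+p. ennreal (?g (fst p) * ?g (snd p)) \<partial>noise_measure \<alpha>)"
    using assms by (intro nn_integral_mono ennreal_leI) (auto simp: abs_mult heat_kernel_nonneg intro!: mult_mono)
  also have "\<dots> = (\<integral>\<^sup>+(p :: (real^'N) \<times> (real^'N)). ennreal (r\<^sup>2 * (heat_kernel a (fst p) * heat_kernel a (snd p) + m * (heat_kernel a (fst p) * heat_kernel b (snd p))
      + (m * (heat_kernel b (fst p) * heat_kernel a (snd p)) + m\<^sup>2 * (heat_kernel b (fst p) * heat_kernel b (snd p))))) \<partial>noise_measure \<alpha>)"
    by (intro nn_integral_cong arg_cong[where f = ennreal]) (simp add: power2_eq_square algebra_simps)
  also have "\<dots> = ennreal ?R"
    using i assms by (subst nn_integral_eq_integral) (auto simp: has_bochner_integral_iff heat_kernel_nonneg)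
  finally show ?thesis .
qed

lemma borel_measurable_string_kernel:
  "case_prod (string_kernel t :: real \<Rightarrow> real^'N \<Rightarrow> real) \<in> borel_measurable borel"
  unfolding string_kernel_def borel_prod[symmetric] by measurable

lemma noise_domI:
  fixes f :: "real \<Rightarrow> real^'N \<Rightarrow> real"
  assumes f: "case_prod f \<in> borel_measurable borel"
    and fin: "(\<integral>\<^sup>+u. \<integral>\<^sup>+p. ennreal \<bar>f u (fst p) * f u (snd p)\<bar> \<partial>noise_measure \<alpha> \<partial>lborel) < \<infinity>"
  shows "f \<in> noise_dom \<alpha>"
proof -
  have "case_prod f \<in> borel_measurable (borel \<Otimes>\<^sub>M borel)"
    using f by (simp add: borel_prod)
  then have f'[measurable (raw)]: "(\<lambda>x. f (g x) (h x)) \<in> borel_measurable M"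
    if "g \<in> borel_measurable M" "h \<in> borel_measurable M" for g h and M :: "'b measure"
    using measurable_compose[OF measurable_Pair[OF that], of "case_prod f"] by simp
  have f1: "(\<lambda>x. f u x) \<in> borel_measurable borel" for u
    by (rule f') auto
  have f2: "(\<lambda>p. f u (fst p)) \<in> borel_measurable (borel \<Otimes>\<^sub>M borel)" "(\<lambda>p. f u (snd p)) \<in> borel_measurable (borel \<Otimes>\<^sub>M borel)" for u
    by (auto intro: measurable_compose[OF _ f1])
  have m: "(\<lambda>p. ennreal \<bar>f u (fst p) * f u (snd p)\<bar>) \<in> borel_measurable (borel \<Otimes>\<^sub>M borel)" for u
    using f2 by measurable
  show ?thesis
  proof (cases "\<alpha> = 1")
    case True
    have "integrable (lborel \<Otimes>\<^sub>M lborel) (\<lambda>p. f (fst p) (snd p) * f (fst p) (snd p))"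
    proof (rule integrableI_bounded)
      have "(\<lambda>p. f (fst p) (snd p)) \<in> borel_measurable (lborel \<Otimes>\<^sub>M lborel)"
        by (rule f') auto
      then show mm: "(\<lambda>p. f (fst p) (snd p) * f (fst p) (snd p)) \<in> borel_measurable (lborel \<Otimes>\<^sub>M lborel)"
        by measurable
      have "(\<integral>\<^sup>+p. ennreal (norm (f (fst p) (snd p) * f (fst p) (snd p))) \<partial>(lborel \<Otimes>\<^sub>M lborel)) =
         (\<integral>\<^sup>+u. \<integral>\<^sup>+x. ennreal \<bar>f u x * f u x\<bar> \<partial>lborel \<partial>lborel)"
        using mm by (subst lborel.nn_integral_fst[symmetric]) simp_all
      then show "(\<integral>\<^sup>+p. ennreal (norm (f (fst p) (snd p) * f (fst p) (snd p))) \<partial>(lborel \<Otimes>\<^sub>M lborel)) < \<infinity>"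
        using fin True by (simp add: nn_integral_noise_measure[OF m])
    qed
    then show ?thesis
      using f True by (simp add: noise_dom_def lborel_prod case_prod_unfold)
  next
    case False
    let ?G = "\<lambda>q :: real \<times> (real^'N) \<times> (real^'N). f (fst q) (fst (snd q)) * f (fst q) (snd (snd q)) * norm (fst (snd q) - snd (snd q)) powr (- \<alpha>)"
    have "integrable (lborel \<Otimes>\<^sub>M (lborel \<Otimes>\<^sub>M lborel)) ?G"
    proof (rule integrableI_bounded)
      have "(\<lambda>q. f (fst q) (fst (snd q))) \<in> borel_measurable (lborel \<Otimes>\<^sub>M (lborel \<Otimes>\<^sub>M lborel))"
        "(\<lambda>q. f (fst q) (snd (snd q))) \<in> borel_measurable (lborel \<Otimes>\<^sub>M (lborel \<Otimes>\<^sub>M lborel))"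
        by (rule f'; measurable)+
      then show mm: "?G \<in> borel_measurable (lborel \<Otimes>\<^sub>M (lborel \<Otimes>\<^sub>M lborel))"
        by measurable
      have sf: "sigma_finite_measure (lborel \<Otimes>\<^sub>M lborel :: ((real^'N) \<times> (real^'N)) measure)"
        by (simp add: lborel.sigma_finite_measure_axioms lborel_prod)
      have "(\<integral>\<^sup>+q. ennreal (norm (?G q)) \<partial>(lborel \<Otimes>\<^sub>M (lborel \<Otimes>\<^sub>M lborel))) =
         (\<integral>\<^sup>+u. \<integral>\<^sup>+p. ennreal (norm (?G (u, p))) \<partial>(lborel \<Otimes>\<^sub>M lborel) \<partial>lborel)"
        using mm by (subst sigma_finite_measure.nn_integral_fst[OF sf, symmetric]) simp_all
      also have "\<dots> = (\<integral>\<^sup>+u. \<integral>\<^sup>+x. \<integral>\<^sup>+y. ennreal (norm (?G (u, x, y))) \<partial>lborel \<partial>lborel \<partial>lborel)"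
        using f2 by (intro nn_integral_cong, subst lborel.nn_integral_fst[symmetric]) simp_all
      also have "\<dots> = (\<integral>\<^sup>+u. \<integral>\<^sup>+p. ennreal \<bar>f u (fst p) * f u (snd p)\<bar> \<partial>noise_measure \<alpha> \<partial>lborel)"
        unfolding nn_integral_noise_measure[OF m]
        using False by (simp add: abs_mult mult_ac flip: ennreal_mult)
      finally show "(\<integral>\<^sup>+q. ennreal (norm (?G q)) \<partial>(lborel \<Otimes>\<^sub>M (lborel \<Otimes>\<^sub>M lborel))) < \<infinity>"
        using fin by simp
    qed
    then show ?thesis
      using f False by (simp add: noise_dom_def lborel_prod case_prod_unfold)
  qed
qed

lemma string_kernel_0: "string_kernel 0 = (\<lambda>_ _. 0)"
  by (simp add: string_kernel_def fun_eq_iff)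

text \<open>The majorant \<open>D\<close> treats three ranges of \<open>u\<close>. Before
  \<open>- t\<close> the cancellation in the kernel is exploited; between \<open>- t\<close> and 0
  the two heat kernels are bounded separately, leaving a singularity at 0 that is integrable as
  \<open>p > 0\<close>; between 0 and \<open>t\<close> only one kernel is present.\<close>

lemma string_kernel_noise_dom:
  assumes ad: "admissible CARD('N) \<alpha>" and "0 \<le> t"
  shows "(string_kernel t :: real \<Rightarrow> real^'N \<Rightarrow> real) \<in> noise_dom \<alpha>"
proof (rule noise_domI[OF borel_measurable_string_kernel])
  let ?k = "string_kernel t :: real \<Rightarrow> real^'N \<Rightarrow> real"
  let ?I = "\<lambda>u. \<integral>\<^sup>+p. ennreal \<bar>?k u (fst p) * ?k u (snd p)\<bar> \<partial>noise_measure \<alpha>"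
  show "(\<integral>\<^sup>+u. ?I u \<partial>lborel) < \<infinity>"
  proof (cases "t = 0")
    case True
    then show ?thesis by (simp add: string_kernel_0)
  next
    case False
    with \<open>0 \<le> t\<close> have t: "t > 0" by simp
    define p where "p = 1 - \<alpha> / 2"
    define C where "C = heat_const CARD('N) \<alpha>"
    let ?P = "heat_cov CARD('N) \<alpha>"
    have p: "0 < p" "p < 1" and N: "CARD('N) \<le> 2" using admissibleD[OF ad] by (auto simp: p_def)
    have C: "C \<ge> 0" unfolding C_def by (rule heat_const_nonneg[OF ad])
    \<comment> \<open>Since \<open>p - 1 < 0\<close>, the pairing decreases in \<open>a + b\<close>,
      so a lower bound on the times is an upper bound here.\<close>
    have P_le: "?P a b \<le> C * c powr (p - 1)" if "0 < c" "c \<le> a + b" for a b c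
    proof (cases "a > 0 \<and> b > 0")
      case True
      then have "?P a b = C * (a + b) powr (p - 1)" by (simp add: heat_cov_def C_def p_def)
      then show ?thesis
        using that p C by (auto intro!: mult_left_mono powr_mono2')
    next
      case False
      then show ?thesis using C by (auto simp: heat_cov_def)
    qed
    \<comment> \<open>The factor 81 is the square of 1 + 8, the coefficients in the bound for the
      difference of heat kernels; the factor 4 counts the pairings of two kernels with two.\<close>
    define D where "D u = 81 * C * t\<^sup>2 * (2 * t) powr (p - 1) * (indicator {..<- t} u *\<^sub>R (1 / u\<^sup>2))
       + (4 * C * (indicator {- t<..<0} u *\<^sub>R (0 - 2 * u) powr (p - 1))
       + C * (indicator {0<..<t} u *\<^sub>R (2 * t - 2 * u) powr (p - 1)))" for u
    have "integrable lborel D"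
      unfolding D_def
      using set_integrable_inverse_square[OF t] set_integral_powr(1)[OF p(1), of "- t" 0 0]
        set_integral_powr(1)[OF p(1), of 0 t "2 * t"] t
      unfolding set_integrable_def
      by (intro Bochner_Integration.integrable_add integrable_mult_right) simp_all
    moreover have D: "D u \<ge> 0" for u using C by (simp add: D_def)
    ultimately have "(\<integral>\<^sup>+u. ennreal (D u) \<partial>lborel) < \<infinity>"
      by (subst nn_integral_eq_integral) auto
    moreover have "(\<integral>\<^sup>+u. ?I u \<partial>lborel) \<le> (\<integral>\<^sup>+u. ennreal (D u) \<partial>lborel)"
    proof (rule nn_integral_mono_AE)
      show "AE u in lborel. ?I u \<le> ennreal (D u)"
        using AE_lborel_singleton[of 0] AE_lborel_singleton[of "- t"] AE_lborel_singleton[of t]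
      proof eventually_elim
        case (elim u)
        have near: "?I u \<le> ennreal (?P (t - u) (t - u) + ?P (t - u) (- u) + (?P (- u) (t - u) + ?P (- u) (- u)))"
          using nn_integral_noise_measure_bound[OF ad, of 1 1 "?k u" "t - u" "- u"]
          by (simp add: string_kernel_def heat_kernel_nonneg abs_le_iff)
        consider "u < - t" | "- t < u" "u < 0" | "0 < u" "u < t" | "t < u" using elim by linarith
        then show ?case
        proof cases
          case 1
          \<comment> \<open>The difference bound with \<open>a = - u\<close> requires
            \<open>b \<le> 2 * a\<close>, that is, \<open>u \<le> - t\<close>; this fixes the cut at
            \<open>- t\<close>. It also gives \<open>2 * t \<le> b\<close>, the source of the
            constant power of \<open>2 * t\<close>.\<close>
          define b where "b = t - u"
          have b: "2 * t \<le> b" "0 < b" using 1 t by (auto simp: b_def)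
          have "\<bar>?k u x\<bar> \<le> t / (- u) * (heat_kernel b x + 8 * heat_kernel (2 * b) x)" for x
            using heat_kernel_diff_bound[OF N, of "- u" b x] 1 t by (simp add: string_kernel_def b_def)
          then have "?I u \<le> ennreal ((t / (- u))\<^sup>2 * (?P b b + 8 * ?P b (2 * b) + (8 * ?P (2 * b) b + 8\<^sup>2 * ?P (2 * b) (2 * b))))"
            using 1 t by (intro nn_integral_noise_measure_bound[OF ad]) (auto simp: divide_nonneg_neg)
          also have "\<dots> \<le> ennreal ((t / (- u))\<^sup>2 * (81 * (C * (2 * t) powr (p - 1))))"
          proof (intro ennreal_leI mult_left_mono)
            have "?P b b \<le> C * (2 * t) powr (p - 1)" "?P b (2 * b) \<le> C * (2 * t) powr (p - 1)"
              "?P (2 * b) b \<le> C * (2 * t) powr (p - 1)" "?P (2 * b) (2 * b) \<le> C * (2 * t) powr (p - 1)"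
              using b t by (auto intro!: P_le)
            then show "?P b b + 8 * ?P b (2 * b) + (8 * ?P (2 * b) b + 8\<^sup>2 * ?P (2 * b) (2 * b)) \<le> 81 * (C * (2 * t) powr (p - 1))"
              by simp
          qed simp
          also have "\<dots> = ennreal (D u)"
            using 1 t by (simp add: D_def power_divide mult_ac)
          finally show ?thesis .
        next
          case 2
          have le: "?P a b \<le> C * (- 2 * u) powr (p - 1)" if "- u \<le> a" "- u \<le> b" for a b
            using 2 that by (intro P_le) auto
          note near
          also have "ennreal (?P (t - u) (t - u) + ?P (t - u) (- u) + (?P (- u) (t - u) + ?P (- u) (- u))) \<le> ennreal (D u)"
            using le[of "t - u" "t - u"] le[of "t - u" "- u"] le[of "- u" "t - u"] le[of "- u" "- u"] 2 t
            by (intro ennreal_leI) (simp add: D_def)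
          finally show ?thesis .
        next
          case 3
          note near
          also have "ennreal (?P (t - u) (t - u) + ?P (t - u) (- u) + (?P (- u) (t - u) + ?P (- u) (- u))) \<le> ennreal (D u)"
            using P_le[of "2 * t - 2 * u" "t - u" "t - u"] 3 by (intro ennreal_leI) (simp add: D_def heat_cov_def)
          finally show ?thesis .
        next
          case 4
          with t have "?k u x = 0" for x by (simp add: string_kernel_def heat_kernel_def)
          then show ?thesis by simp
        qed
      qed
    qed
    ultimately show ?thesis by (rule le_less_trans[rotated])
  qed
qed

section \<open>The normalising constant\<close>

text \<open>Put \<open>p = 1 - \<alpha> / 2\<close>. In units of
  \<open>heat_const N \<alpha>\<close>, the variance at time 1 is
  \<open>(2 - 2 powr p) / (2 * p)\<close> from the noise before time 0 plus
  \<open>2 powr p / (2 * p)\<close> from the noise between 0 and 1. The sum \<open>1 / p\<close> is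
  what the square of the constant has to compensate.\<close>

lemma string_const_heat_const:
  assumes "admissible N \<alpha>"
  shows "(string_const N \<alpha>)\<^sup>2 * (heat_const N \<alpha> / (1 - \<alpha> / 2)) = 1"
proof (cases "\<alpha> = 1")
  case True
  then have N: "N = 1" using admissibleD(5)[OF assms] by simp
  have "(string_const N \<alpha>)\<^sup>2 = (2 powr (- 1 / 2) * 2 powr (- 1 / 2)) * ((4 * pi) powr (1 / 4) * (4 * pi) powr (1 / 4))"
    using True N by (simp add: string_const_def power2_eq_square)
  also have "\<dots> = 1 / 2 * (4 * pi) powr (1 / 2)"
    unfolding powr_add[symmetric] by (simp add: powr_minus_divide)
  finally have "(string_const N \<alpha>)\<^sup>2 * (heat_const N \<alpha> / (1 - \<alpha> / 2)) = (4 * pi) powr (1 / 2) * (4 * pi) powr (- (1 / 2))"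
    using True by (simp add: heat_const_def)
  also have "\<dots> = 1" unfolding powr_add[symmetric] by simp
  finally show ?thesis .
next
  case False
  note adD = admissibleD[OF assms]
  have g: "Gamma (real N / 2) > 0" "Gamma ((real N - \<alpha>) / 2) > 0"
    using adD False by (auto intro!: Gamma_real_pos)
  have 4: "(4::real) powr (- (\<alpha> / 2)) = 2 powr (- \<alpha>)"
    using powr_powr[of "2::real" 2 "- (\<alpha> / 2)"] by simp
  have 2: "(2::real) powr (- \<alpha> + 1) = 2 * 2 powr (- \<alpha>)"
    by (simp only: powr_add) simp
  have sq: "(string_const N \<alpha>)\<^sup>2 = ((2 - \<alpha>) * Gamma (real N / 2)) / (2 powr (- \<alpha> + 1) * Gamma ((real N - \<alpha>) / 2))"
    using False adD g by (simp add: string_const_def)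
  have eq: "((2 - \<alpha>) * A) / (2 * E * B) * (B / A * E / (1 - \<alpha> / 2)) = 1"
    if "A > 0" "B > 0" "E > 0" for A B E :: real
    using that adD(2) by (simp add: field_simps)
  have "((2 - \<alpha>) * Gamma (real N / 2)) / (2 * 2 powr (- \<alpha>) * Gamma ((real N - \<alpha>) / 2)) *
      (Gamma ((real N - \<alpha>) / 2) / Gamma (real N / 2) * 2 powr (- \<alpha>) / (1 - \<alpha> / 2)) = 1"
    by (rule eq[OF g]) simp
  then show ?thesis
    using False unfolding sq heat_const_def riesz_const_def 4 2 by (simp only: if_False)
qed

theorem proposition1:
  fixes M :: "'w measure"
    and F :: "(real \<Rightarrow> real ^ 'N \<Rightarrow> real) \<Rightarrow> 'w \<Rightarrow> real ^ 'n"
    and \<alpha> :: real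
  assumes "prob_space M"
    and "(CARD('N) = 1 \<and> 0 < \<alpha> \<and> \<alpha> \<le> 1) \<or> (CARD('N) = 2 \<and> 1 < \<alpha> \<and> \<alpha> < 2)"
    and "gaussian_noise M \<alpha> F"
  shows "fractional_brownian_motion M ((2 - \<alpha>) / 4)
           (\<lambda>t \<omega>. string_const CARD('N) \<alpha> *\<^sub>R pinned_string F t 0 \<omega>)"
proof -
  have ad: "admissible CARD('N) \<alpha>"
    using assms(2) by (simp add: admissible_def)
  let ?f = "\<lambda>t s y. if s \<le> t then heat_kernel (t - s) (0 - y) - heat_kernel (- s) (- y :: real^'N) else 0"
  let ?K = "string_const CARD('N) \<alpha>"
  have "fractional_brownian_motion M ((2 - \<alpha>) / 4) (\<lambda>t \<omega>. ?K *\<^sub>R F (?f t) \<omega>)"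
  proof (rule fractional_brownian_motion_noise[OF assms(1,3)])
    show "0 < (2 - \<alpha>) / 4" "(2 - \<alpha>) / 4 \<le> 1" using admissibleD[OF ad] by auto
    show "?f t \<in> noise_dom \<alpha>" if "t \<ge> 0" for t
      unfolding pinned_kernel_eq_string_kernel[OF that] by (rule string_kernel_noise_dom[OF ad that])
    show "?f 0 = (\<lambda>_ _. 0)"
      using pinned_kernel_eq_string_kernel[of 0] by (simp add: string_kernel_0)
    fix s t :: real assume st: "s \<ge> 0" "t \<ge> 0"
    let ?p = "1 - \<alpha> / 2"
    have "?K\<^sup>2 * noise_cov \<alpha> (?f s) (?f t) =
      (?K\<^sup>2 * (heat_const CARD('N) \<alpha> / ?p)) * ((s powr ?p + t powr ?p - \<bar>t - s\<bar> powr ?p) / 2)"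
      unfolding pinned_kernel_eq_string_kernel[OF st(1)] pinned_kernel_eq_string_kernel[OF st(2)]
      by (simp add: noise_cov_string_kernel[OF ad] integral_string_cov[OF ad st])
    also have "\<dots> = (s powr ?p + t powr ?p - \<bar>t - s\<bar> powr ?p) / 2"
      unfolding string_const_heat_const[OF ad] by simp
    also have "?p = 2 * ((2 - \<alpha>) / 4)" by (simp add: field_simps)
    finally show "?K\<^sup>2 * noise_cov \<alpha> (?f s) (?f t) =
      (s powr (2 * ((2 - \<alpha>) / 4)) + t powr (2 * ((2 - \<alpha>) / 4)) - \<bar>t - s\<bar> powr (2 * ((2 - \<alpha>) / 4))) / 2" .
  qed
  then show ?thesis
    unfolding pinned_string_def .
qed

end
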